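(* Let $U$ be a measurable function on $(0,\infty)$ whose Mellin transform $MU(z)$ converges at least in the strip $\sigma\le\Re(z)\le\tau$, where $-\infty<\sigma<\tau<\infty$. Let $f$ be a measurable function on $(0,\infty)$, and assume the following conditions hold: 1. $f(y^{-1})=y^{-\rho}l(y)(1+O(h(y)))$ as $y\to\infty$, where $\rho\in(\sigma,\tau)$, $l\in R_0^g$ with $g\in R_0$, and $h\in\mathcal{Z}$. The functions $g$ and $h$ satisfy $g(y)\to0$ and $h(y)\to0$ as $y\to\infty$. 2. The functions $g$, $l^{-1}$ and $g^{-1}$ are locally bounded on the interval $(x_0,\infty)$ for some $x_0>0$. 3. The function $y\mapsto y^{\tau}f(y^{-1})$ is bounded on every interval $(0,a]$ where $a>0$. Then $$(U\stackrel{M}{\star}f)(x)=MU(\rho)\,[x^{\rho}l(x^{-1})]\,\bigl(1+O(g(x^{-1}))+O(h(x^{-1}))\bigr)\qquad\text{as }x\to0.$$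
   Context: Mellin transform: $MU(z)=\int_0^\infty t^{-z}U(t)\,\frac{dt}{t}$, with domain the set of all $z\in\mathbb{C}$ for which the integral converges absolutely. Mellin convolution of two real Lebesgue measurable functions on $(0,\infty)$: $(f\stackrel{M}{\star}g)(x)=\int_0^\infty f(t^{-1}x)g(t)\frac{dt}{t}$ for those $x>0$ for which the integral exists. $R_0$ (slowly varying functions): nonnegative measurable functions $f$ on $(0,\infty)$ with $f(\lambda x)/f(x)\to1$ as $x\to\infty$ for every $\lambda>0$. $R_0^g$ (slowly varying functions with remainder $g$, where $g$ is a nonnegative measurable function on $(0,\infty)$ with $g(x)\to0$ as $x\to\infty$): nonnegative measurable functions $l$ on $(0,\infty)$ such that for all $\lambda>1$, $\frac{l(\lambda x)}{l(x)}-1=O(g(x))$ as $x\to\infty$. Zygmund class $\mathcal{Z}$: nonnegative measurable functions $l$ on $(0,\infty)$ such that for every $\alpha>0$ the function $x^{\alpha}l(x)$ is ultimately increasing and the function $x^{-\alpha}l(x)$ is ultimately decreasing. $\phi_1(x)=O(\phi_2(x))$ as $x\to\infty$ (respectively, as $x\to0$) means: there exist $c>0$ and $x_0>0$ such that $|\phi_1(x)|\le c\,\phi_2(x)$ for all $x>x_0$ (respectively, for all $0<x<x_0$).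
   Formalization: The stated formula is proved when MU(ρ)≠0; for MU(ρ)=0 it would force the convolution to vanish near 0, which can fail, so for every MU(ρ) the form x^ρ l(1/x)(MU(ρ)+O(g(1/x))+O(h(1/x))) is proved instead. *)

theory Defs
  imports "HOL-Analysis.Analysis" "HOL-Library.Landau_Symbols"
begin

abbreviation half_line :: "real measure" where
  "half_line \<equiv> lebesgue_on {0<..}"

definition mellin_integrand :: "(real \<Rightarrow> real) \<Rightarrow> complex \<Rightarrow> real \<Rightarrow> complex" where
  "mellin_integrand U z t = of_real t powr (-z) * of_real (U t) / of_real t"

definition mellin_domain :: "(real \<Rightarrow> real) \<Rightarrow> complex set" where
  "mellin_domain U = {z. integrable half_line (mellin_integrand U z)}"

text \<open>The Bochner integral is \<open>0\<close> by convention outside \<^term>\<open>mellin_domain U\<close>.\<close>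

definition mellin :: "(real \<Rightarrow> real) \<Rightarrow> complex \<Rightarrow> complex" where
  "mellin U z = (LINT t|half_line. mellin_integrand U z t)"

definition mellin_conv_exists :: "(real \<Rightarrow> real) \<Rightarrow> (real \<Rightarrow> real) \<Rightarrow> real \<Rightarrow> bool" where
  "mellin_conv_exists f g x \<longleftrightarrow> integrable half_line (\<lambda>t. f (inverse t * x) * g t / t)"

text \<open>Meaningful only at points \<open>x > 0\<close> where \<^const>\<open>mellin_conv_exists\<close> holds.\<close>

definition mellin_conv :: "(real \<Rightarrow> real) \<Rightarrow> (real \<Rightarrow> real) \<Rightarrow> real \<Rightarrow> real" where
  "mellin_conv f g x = (LINT t|half_line. f (inverse t * x) * g t / t)"

definition nonneg_measurable :: "(real \<Rightarrow> real) set" where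
  "nonneg_measurable = {f. f \<in> borel_measurable half_line \<and> (\<forall>x>0. 0 \<le> f x)}"

text \<open>
  Since \<open>0 / 0 = 0\<close> in HOL, the limit condition below (and likewise the \<open>O\<close>-condition in
  \<open>slowly_varying_rem\<close> when the remainder tends to \<open>0\<close>) forces the function to be
  ultimately nonzero, so the quotients are ultimately genuine.
\<close>

definition slowly_varying :: "(real \<Rightarrow> real) set" where
  "slowly_varying =
     {f \<in> nonneg_measurable. \<forall>c>0. ((\<lambda>x. f (c * x) / f x) \<longlongrightarrow> 1) at_top}"

definition slowly_varying_rem :: "(real \<Rightarrow> real) \<Rightarrow> (real \<Rightarrow> real) set" where
  "slowly_varying_rem g =
     {l \<in> nonneg_measurable. \<forall>c>1. (\<lambda>x. l (c * x) / l x - 1) \<in> O[at_top](g)}"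

text \<open>``Increasing'' and ``decreasing'' are taken in the weak sense.\<close>

definition zygmund :: "(real \<Rightarrow> real) set" where
  "zygmund =
     {l \<in> nonneg_measurable. \<forall>\<alpha>>0.
        (\<exists>X>0. mono_on {X<..} (\<lambda>x. x powr \<alpha> * l x)) \<and>
        (\<exists>X>0. antimono_on {X<..} (\<lambda>x. x powr (-\<alpha>) * l x))}"

definition locally_bounded_on :: "real set \<Rightarrow> (real \<Rightarrow> real) \<Rightarrow> bool" where
  "locally_bounded_on S f \<longleftrightarrow> (\<forall>K. compact K \<and> K \<subseteq> S \<longrightarrow> bounded (f ` K))"

text \<open>
  For the reciprocal to be locally bounded it has to be defined as a real number at every
  point, which the HOL convention \<open>inverse 0 = 0\<close> would not enforce.
\<close>

definition reciprocal_locally_bounded_on :: "real set \<Rightarrow> (real \<Rightarrow> real) \<Rightarrow> bool" where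
  "reciprocal_locally_bounded_on S f \<longleftrightarrow>
     (\<forall>x\<in>S. f x \<noteq> 0) \<and> locally_bounded_on S (\<lambda>x. inverse (f x))"

end

theory Submission
  imports Defs
begin

text \<open>
  With \<open>y = 1/x\<close> the convolution is \<open>\<integral> U(s) F(y s) ds/s\<close>, where \<open>F(y) = f(1/y)\<close>. A measure overlap
  argument makes the pointwise estimates for \<open>ln (l (c y)) - ln (l y)\<close> uniform for \<open>c \<in> [1,2]\<close>, and
  summing over dyadic scales gives, for all large \<open>y\<close> and \<open>z\<close>,
  \<open>|l(z)/l(y) - 1| \<le> K g(y) ((z/y)^\<epsilon> + (z/y)^-\<epsilon>)\<close>. The Zygmund property gives the analogous bound for \<open>h\<close>.
  Hence \<open>F(ys)/(y^-\<rho> l(y)) - s^-\<rho>\<close> is at most \<open>K (g(y) + h(y)) (s^-\<sigma> + s^-\<tau>)\<close> in absolute value: where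
  \<open>y s\<close> is bounded this follows from the boundedness of \<open>z^\<tau> F(z)\<close> near \<open>0\<close>, because \<open>g\<close> and \<open>l\<close>
  dominate every negative power of \<open>y\<close>. Integrating against \<open>|U(s)| ds/s\<close> yields the claim.
\<close>

subsection \<open>Uniform bounds for multiplicative increments\<close>

text \<open>Egorov-type argument: each \<open>c\<close> in \<open>[1,b]\<close> has its own constant
  and threshold, so it lies in \<open>V N\<close> for all large \<open>N\<close>, and continuity of
  measure does the rest. Passing to a sequence \<open>x n\<close> keeps the defining conditions
  countable, hence \<open>V N\<close> measurable.\<close>

lemma measure_increment_set_tendsto:
  fixes P G :: "real \<Rightarrow> real" and x :: "nat \<Rightarrow> real"
  assumes P: "P \<in> borel_measurable half_line"
    and pt: "\<And>c. c \<ge> 1 \<Longrightarrow> \<exists>C. \<forall>\<^sub>F u in at_top. \<bar>P (c * u) - P u\<bar> \<le> C * G u"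
    and G0: "\<forall>\<^sub>F u in at_top. 0 \<le> G u"
    and x: "filterlim x at_top sequentially" and x_pos: "\<And>n. 0 < x n"
    and b: "1 \<le> b"
  defines "V \<equiv> \<lambda>N::nat. {c \<in> {1..b}. \<forall>n\<ge>N. \<bar>P (c * x n) - P (x n)\<bar> \<le> real N * G (x n)}"
  shows "V N \<in> lmeasurable" and "(\<lambda>N. measure lebesgue (V N)) \<longlonglongrightarrow> b - 1"
proof -
  \<comment> \<open>Extending \<open>P\<close> by zero gives a function on the whole line, where
    scaling by \<open>x n\<close> is known to preserve Lebesgue measurability.\<close>
  define P' where "P' = (\<lambda>t. indicator {0<..} t *\<^sub>R P t)"
  have [measurable]: "P' \<in> borel_measurable lebesgue"
    using P unfolding P'_def by (subst (asm) borel_measurable_restrict_space_iff) auto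
  have [measurable]: "(\<lambda>c. P' (c * x n)) \<in> borel_measurable lebesgue" for n
    using measurable_compose[OF lebesgue_measurable_scaling[of "x n"] \<open>P' \<in> borel_measurable lebesgue\<close>]
    by (simp add: mult.commute)
  have V: "V N = {1..b} \<inter> (\<Inter>n\<in>{N..}. {c \<in> space lebesgue. \<bar>P' (c * x n) - P (x n)\<bar> \<le> real N * G (x n)})" for N
    using x_pos by (auto simp: V_def P'_def indicator_def)
  have "{c \<in> space lebesgue. \<bar>P' (c * x n) - P (x n)\<bar> \<le> real N * G (x n)} \<in> sets lebesgue" for n N
    by (rule borel_measurable_le) simp_all
  then have V_sets: "V N \<in> sets lebesgue" for N
    unfolding V by (intro sets.Int sets.countable_INT') auto
  show V_lm: "V N \<in> lmeasurable" for N
    by (rule fmeasurableI2[of "{1..b}", OF _ _ V_sets]) (auto simp: V_def)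
  \<comment> \<open>\<open>V\<close> itself need not increase with \<open>N\<close>, since \<open>G\<close> may be negative early on.\<close>
  define M where "M = (\<lambda>N. if \<forall>n\<ge>N. 0 \<le> G (x n) then V N else {})"
  have M_sets: "M N \<in> sets lebesgue" for N
    using V_sets[of N] by (simp add: M_def)
  have inc: "incseq M"
  proof (rule monoI)
    fix m n :: nat assume "m \<le> n"
    show "M m \<subseteq> M n"
    proof
      fix c assume c: "c \<in> M m"
      have "\<bar>P (c * x k) - P (x k)\<bar> \<le> real n * G (x k)" if "k \<ge> n" for k
      proof -
        have "\<bar>P (c * x k) - P (x k)\<bar> \<le> real m * G (x k)" "0 \<le> G (x k)"
          using c that \<open>m \<le> n\<close> by (auto simp: M_def V_def split: if_splits)
        with \<open>m \<le> n\<close> show ?thesis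
          by (meson mult_right_mono of_nat_mono order_trans)
      qed
      with c \<open>m \<le> n\<close> show "c \<in> M n" by (auto simp: M_def V_def split: if_splits)
    qed
  qed
  have un: "(\<Union>N. M N) = {1..b}"
  proof
    show "{1..b} \<subseteq> (\<Union>N. M N)"
    proof
      fix c assume c: "c \<in> {1..b}"
      then obtain C where "\<forall>\<^sub>F u in at_top. \<bar>P (c * u) - P u\<bar> \<le> C * G u" using pt by force
      with G0 have "\<forall>\<^sub>F u in at_top. \<bar>P (c * u) - P u\<bar> \<le> C * G u \<and> 0 \<le> G u"
        by eventually_elim auto
      with x have "\<forall>\<^sub>F n in sequentially. \<bar>P (c * x n) - P (x n)\<bar> \<le> C * G (x n) \<and> 0 \<le> G (x n)"
        by (auto simp: filterlim_iff)
      then obtain N0 where N0: "\<And>n. n \<ge> N0 \<Longrightarrow> \<bar>P (c * x n) - P (x n)\<bar> \<le> C * G (x n) \<and> 0 \<le> G (x n)"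
        by (auto simp: eventually_sequentially)
      \<comment> \<open>\<open>N\<close> plays two roles in \<open>V N\<close>, as starting index
        and as constant, so it must exceed both \<open>N0\<close> and \<open>C\<close>.\<close>
      define N where "N = max N0 (nat \<lceil>C\<rceil>)"
      have "C \<le> real N" unfolding N_def by linarith
      have "\<bar>P (c * x n) - P (x n)\<bar> \<le> real N * G (x n) \<and> 0 \<le> G (x n)" if "n \<ge> N" for n
        using N0[of n] that mult_right_mono[OF \<open>C \<le> real N\<close>, of "G (x n)"] by (auto simp: N_def)
      with c have "c \<in> M N" by (auto simp: M_def V_def)
      then show "c \<in> (\<Union>N. M N)" by blast
    qed
  qed (auto simp: M_def V_def split: if_splits)
  have "(\<lambda>N. measure lebesgue (M N)) \<longlonglongrightarrow> measure lebesgue (\<Union>N. M N)"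
    using M_sets inc by (intro Lim_measure_incseq) (auto simp: un emeasure_lborel_Icc_eq)
  then have "(\<lambda>N. measure lebesgue (M N)) \<longlonglongrightarrow> b - 1"
    using b by (simp add: un)
  then show "(\<lambda>N. measure lebesgue (V N)) \<longlonglongrightarrow> b - 1"
  proof (rule tendsto_sandwich[rotated 2])
    show "\<forall>\<^sub>F N in sequentially. measure lebesgue (M N) \<le> measure lebesgue (V N)"
      by (intro always_eventually allI measure_mono_fmeasurable) (auto simp: V_sets V_lm M_def)
    have "measure lebesgue (V N) \<le> measure lebesgue {1..b}" for N
      by (rule measure_mono_fmeasurable[OF _ V_sets]) (auto simp: V_def)
    then show "\<forall>\<^sub>F N in sequentially. measure lebesgue (V N) \<le> b - 1"
      using b by simp
  qed auto
qed

text \<open>Uniform convergence theorem with a weight. If the bound failed along \<open>u n\<close>,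
  \<open>v n\<close>, then some \<open>w\<close> would have \<open>v n * w\<close> good for base
  point \<open>u n\<close> and \<open>w\<close> good for base point \<open>v n * u n\<close>. Both
  increments end at \<open>v n * w * u n\<close>, so their difference controls the offending
  increment; \<open>GK\<close> replaces \<open>G (v n * u n)\<close> by
  \<open>G (u n)\<close>.\<close>

lemma uniform_increment_bound:
  fixes P G :: "real \<Rightarrow> real"
  assumes P: "P \<in> borel_measurable half_line"
    and pt: "\<And>c. c \<ge> 1 \<Longrightarrow> \<exists>C. \<forall>\<^sub>F u in at_top. \<bar>P (c * u) - P u\<bar> \<le> C * G u"
    and G0: "\<forall>\<^sub>F u in at_top. 0 \<le> G u"
    and GK: "\<forall>\<^sub>F u in at_top. \<forall>v\<in>{1..2}. G (v * u) \<le> K * G u"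
  shows "\<exists>C. \<forall>\<^sub>F u in at_top. \<forall>v\<in>{1..2}. \<bar>P (v * u) - P u\<bar> \<le> C * G u"
proof (rule ccontr)
  assume neg: "\<not> ?thesis"
  have "\<exists>u v. u \<ge> real n \<and> u > 0 \<and> 0 \<le> G u \<and> v \<in> {1..2} \<and> G (v * u) \<le> K * G u \<and>
          \<not> \<bar>P (v * u) - P u\<bar> \<le> real n * G u" for n
  proof -
    have "\<exists>\<^sub>F u in at_top. \<not> (\<forall>v\<in>{1..2}. \<bar>P (v * u) - P u\<bar> \<le> real n * G u)"
      using neg by (auto simp: frequently_def)
    moreover have "\<forall>\<^sub>F u in at_top. u \<ge> real n \<and> u > 0 \<and> 0 \<le> G u \<and> (\<forall>v\<in>{1..2}. G (v * u) \<le> K * G u)"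
      using G0 GK eventually_ge_at_top[of "real n"] eventually_gt_at_top[of "0::real"]
      by eventually_elim auto
    ultimately have "\<exists>\<^sub>F u in at_top. \<not> (\<forall>v\<in>{1..2}. \<bar>P (v * u) - P u\<bar> \<le> real n * G u) \<and>
        u \<ge> real n \<and> u > 0 \<and> 0 \<le> G u \<and> (\<forall>v\<in>{1..2}. G (v * u) \<le> K * G u)"
      by (rule frequently_eventually_conj[of _ _ _, THEN frequently_elim1]) auto
    then show ?thesis by (force dest: frequently_ex)
  qed
  then obtain u v where uv: "\<And>n. u n \<ge> real n" "\<And>n. u n > 0" "\<And>n. 0 \<le> G (u n)"
      "\<And>n. v n \<in> {1..2}" "\<And>n. G (v n * u n) \<le> K * G (u n)"
      "\<And>n. \<not> \<bar>P (v n * u n) - P (u n)\<bar> \<le> real n * G (u n)"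
    by metis
  have u_lim: "filterlim u at_top sequentially"
    by (rule filterlim_at_top_mono[OF filterlim_real_sequentially]) (simp add: uv)
  have v: "1 \<le> v n" "v n \<le> 2" for n using uv(4)[of n] by auto
  have vu_lim: "filterlim (\<lambda>n. v n * u n) at_top sequentially"
  proof (rule filterlim_at_top_mono[OF u_lim], intro always_eventually allI)
    show "u n \<le> v n * u n" for n
      using mult_right_mono[OF v(1)[of n], of "u n"] uv(2)[of n] by simp
  qed
  have vu_pos: "0 < v n * u n" for n
    using uv(2)[of n] v(1)[of n] by simp
  define V where "V = (\<lambda>N::nat. {c \<in> {1..4}. \<forall>n\<ge>N. \<bar>P (c * u n) - P (u n)\<bar> \<le> real N * G (u n)})"
  define W where "W = (\<lambda>N::nat. {c \<in> {1..4}. \<forall>n\<ge>N. \<bar>P (c * (v n * u n)) - P (v n * u n)\<bar> \<le> real N * G (v n * u n)})"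
  note m = measure_increment_set_tendsto[OF P pt G0, where b=4]
  have V_lm: "V N \<in> lmeasurable" and W_lm: "W N \<in> lmeasurable" for N
    unfolding V_def W_def by (rule m(1); use u_lim uv vu_lim vu_pos in simp)+
  have "(\<lambda>N. measure lebesgue (V N)) \<longlonglongrightarrow> 4 - 1"
    unfolding V_def by (rule m(2)) (use u_lim uv in auto)
  moreover have "(\<lambda>N. measure lebesgue (W N)) \<longlonglongrightarrow> 4 - 1"
    unfolding W_def by (rule m(2)) (use vu_lim vu_pos in auto)
  \<comment> \<open>Disjoint sets would have total measure above \<open>5/2 + (5/2) * v n\<close>,
    which exceeds the available length \<open>4 * v n - 1\<close> because
    \<open>v n \<le> 2\<close>.\<close>
  ultimately have "\<forall>\<^sub>F N in sequentially. measure lebesgue (V N) > 5/2 \<and> measure lebesgue (W N) > 5/2"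
    by (intro eventually_conj order_tendstoD(1)) auto
  then obtain N where N: "measure lebesgue (V N) > 5/2" "measure lebesgue (W N) > 5/2"
    by (auto simp: eventually_sequentially)
  \<comment> \<open>\<open>n \<ge> N\<close> makes the conditions in \<open>V N\<close> and
    \<open>W N\<close> apply at index \<open>n\<close>; the second bound absorbs the sum of the two
    increments, at most \<open>N * (K + 1) * G (u n)\<close>.\<close>
  define n where "n = max N (nat \<lceil>real N * (K + 1)\<rceil>)"
  have nN: "n \<ge> N" "real n \<ge> real N * (K + 1)" unfolding n_def by linarith+
  have vW_lm: "(*) (v n) ` W N \<in> lmeasurable" and vW: "measure lebesgue ((*) (v n) ` W N) = v n * measure lebesgue (W N)"
  proof -
    have sets: "(*) (v n) ` W N \<in> sets lebesgue"
      by (rule differentiable_image_in_sets_lebesgue[OF fmeasurableD[OF W_lm]])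
         (auto intro!: derivative_intros)
    show "(*) (v n) ` W N \<in> lmeasurable"
      by (rule fmeasurableI2[OF _ _ sets, of "{0..v n * 4}"]) (use v[of n] in \<open>auto simp: W_def\<close>)
    have "(\<lambda>x. v n *\<^sub>R x + 0) = (*) (v n)" by auto
    with measure_lebesgue_affine[of "v n" 0 "W N"]
    have "measure lebesgue ((*) (v n) ` W N) = \<bar>v n\<bar> ^ DIM(real) * measure lebesgue (W N)" by metis
    with v[of n] show "measure lebesgue ((*) (v n) ` W N) = v n * measure lebesgue (W N)" by simp
  qed
  \<comment> \<open>\<open>v n\<close> times \<open>W N\<close> and \<open>V N\<close> both lie in \<open>[1, 4 v n]\<close>, which is too short to hold them disjointly.\<close>
  have "V N \<inter> (*) (v n) ` W N \<noteq> {}"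
  proof
    assume "V N \<inter> (*) (v n) ` W N = {}"
    then have "measure lebesgue (V N \<union> (*) (v n) ` W N) = measure lebesgue (V N) + v n * measure lebesgue (W N)"
      using V_lm vW_lm by (subst measure_Un3) (auto simp: vW)
    moreover have "v n * (5/2) \<le> v n * measure lebesgue (W N)"
      using N v(1)[of n] by (intro mult_left_mono) auto
    moreover have "measure lebesgue (V N \<union> (*) (v n) ` W N) \<le> measure lebesgue {1..v n * 4}"
    proof (rule measure_mono_fmeasurable)
      have "1 \<le> v n * w \<and> v n * w \<le> v n * 4" if "1 \<le> w" "w \<le> 4" for w
        using mult_mono[of 1 "v n" 1 w] mult_left_mono[of w 4 "v n"] v[of n] that by auto
      then show "V N \<union> (*) (v n) ` W N \<subseteq> {1..v n * 4}"
        using v[of n] by (auto simp: V_def W_def)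
    qed (use V_lm vW_lm in auto)
    moreover have "measure lebesgue {1..v n * 4} = v n * 4 - 1" using v[of n] by simp
    ultimately show False using v[of n] N by linarith
  qed
  then obtain w where w: "w \<in> W N" "v n * w \<in> V N" by auto
  have "\<bar>P (v n * w * u n) - P (u n)\<bar> \<le> real N * G (u n)"
    using w nN by (auto simp: V_def)
  moreover have "\<bar>P (w * (v n * u n)) - P (v n * u n)\<bar> \<le> real N * G (v n * u n)"
    using w nN by (auto simp: W_def)
  moreover have "real N * G (v n * u n) \<le> real N * (K * G (u n))"
    by (intro mult_left_mono uv) auto
  moreover have "real N * (K + 1) * G (u n) \<le> real n * G (u n)"
    by (intro mult_right_mono nN uv)
  ultimately have "\<bar>P (v n * u n) - P (u n)\<bar> \<le> real n * G (u n)"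
    by (simp add: algebra_simps)
  with uv(6)[of n] show False by simp
qed

subsection \<open>Slowly varying functions\<close>

text \<open>Converts the remainder condition on quotients into one on additive increments of the
  logarithm. For \<open>|x| \<le> 1/2\<close> the quadratic error \<open>2 * x^2\<close> of
  \<open>ln (1 + x)\<close> is at most \<open>|x|\<close>, whence the factor 2.\<close>

lemma abs_ln_diff_le:
  fixes a b :: real
  assumes "0 < a" "0 < b" "\<bar>b / a - 1\<bar> \<le> 1 / 2"
  shows "\<bar>ln b - ln a\<bar> \<le> 2 * \<bar>b / a - 1\<bar>"
proof -
  define x where "x = b / a - 1"
  have "\<bar>ln (1 + x) - x\<bar> \<le> 2 * x\<^sup>2"
    using assms by (intro abs_ln_one_plus_x_minus_x_bound) (simp add: x_def)
  moreover have "2 * x\<^sup>2 \<le> \<bar>x\<bar>"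
    using mult_right_mono[of "2 * \<bar>x\<bar>" 1 "\<bar>x\<bar>"] assms(3)
    by (simp add: x_def power2_eq_square flip: abs_mult)
  moreover have "ln (1 + x) = ln b - ln a"
    using assms by (simp add: x_def ln_div)
  ultimately show ?thesis unfolding x_def[symmetric] by linarith
qed

text \<open>The way back from logarithmic increments to quotients; both signs of \<open>z\<close>
  reduce to the tangent inequality for \<open>exp\<close>.\<close>

lemma abs_exp_minus_one_le: "\<bar>exp z - 1\<bar> \<le> \<bar>z\<bar> * exp \<bar>z\<bar>" for z :: real
proof (cases "z \<ge> 0")
  case True
  have "(1 - z) * exp z \<le> exp (- z) * exp z"
    using exp_ge_add_one_self[of "- z"] by (intro mult_right_mono) auto
  with True show ?thesis by (simp add: algebra_simps flip: exp_add)
next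
  case False
  have "1 - exp z \<le> - z" using exp_ge_add_one_self[of z] by linarith
  also have "- z * 1 \<le> - z * exp (- z)" using False by (intro mult_left_mono) auto
  finally show ?thesis using False by simp
qed

text \<open>At a zero of \<open>l\<close> the quotient is 0 by the convention for division, which a
  limit of 1 excludes far out.\<close>

lemma eventually_pos_of_ratio_tendsto:
  fixes l :: "real \<Rightarrow> real"
  assumes "\<And>x. 0 < x \<Longrightarrow> 0 \<le> l x" and "((\<lambda>x. l (c * x) / l x) \<longlongrightarrow> 1) at_top"
  shows "\<forall>\<^sub>F x in at_top. 0 < l x"
proof -
  have "\<forall>\<^sub>F x in at_top. l (c * x) / l x > 0" using assms(2) by (rule order_tendstoD) simp
  then show ?thesis using eventually_gt_at_top[of "0::real"]
  proof eventually_elim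
    case (elim x)
    then show ?case using assms(1)[of x] by (cases "l x = 0") auto
  qed
qed

lemma slowly_varying_eventually_pos:
  assumes "l \<in> slowly_varying"
  shows "\<forall>\<^sub>F x in at_top. 0 < l x"
  by (rule eventually_pos_of_ratio_tendsto[of l 2])
     (use assms in \<open>auto simp: slowly_varying_def nonneg_measurable_def\<close>)

lemma eventually_at_top_scaled:
  fixes c :: real
  assumes "0 < c" "\<forall>\<^sub>F x in at_top. Q x"
  shows "\<forall>\<^sub>F x in at_top. Q (c * x)"
proof -
  have "filterlim (\<lambda>x. c * x) at_top at_top"
    by (rule filterlim_tendsto_pos_mult_at_top[OF tendsto_const assms(1) filterlim_ident])
  then show ?thesis using assms(2) by (auto simp: filterlim_iff)
qed

text \<open>The remainder condition speaks of factors above 1 only. For \<open>c < 1\<close> the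
  limit for \<open>1 / c\<close> is taken along \<open>c * x\<close> and inverted; for
  \<open>c = 1\<close> eventual positivity makes the quotient equal to 1.\<close>

lemma slowly_varying_rem_imp_slowly_varying:
  assumes l: "l \<in> slowly_varying_rem g" and g: "(g \<longlongrightarrow> 0) at_top"
  shows "l \<in> slowly_varying"
proof -
  have lim: "((\<lambda>x. l (c * x) / l x) \<longlongrightarrow> 1) at_top" if "c > 1" for c
  proof -
    have "(\<lambda>x. l (c * x) / l x - 1) \<in> O[at_top](g)"
      using l that by (auto simp: slowly_varying_rem_def)
    then obtain k where "\<forall>\<^sub>F x in at_top. norm (l (c * x) / l x - 1) \<le> k * norm (g x)"
      by (elim landau_o.bigE)
    then have "((\<lambda>x. l (c * x) / l x - 1) \<longlongrightarrow> 0) at_top"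
      by (intro tendsto_0_le[OF g, of _ k]) (simp add: mult.commute)
    from tendsto_add[OF this tendsto_const[of 1]] show ?thesis by simp
  qed
  have nonneg: "0 \<le> l x" if "0 < x" for x
    using l that by (auto simp: slowly_varying_rem_def nonneg_measurable_def)
  have pos: "\<forall>\<^sub>F x in at_top. 0 < l x"
    by (rule eventually_pos_of_ratio_tendsto[OF nonneg lim[of 2]]) auto
  have "((\<lambda>x. l (c * x) / l x) \<longlongrightarrow> 1) at_top" if "c > 0" for c
  proof -
    consider "c > 1" | "c = 1" | "c < 1" by linarith
    then show ?thesis
    proof cases
      case 1
      then show ?thesis by (rule lim)
    next
      case 2
      show ?thesis
        by (rule tendsto_eventually) (use pos in eventually_elim, simp add: 2)
    next
      case 3
      have "filterlim (\<lambda>x. c * x) at_top at_top"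
        by (rule filterlim_tendsto_pos_mult_at_top[OF tendsto_const that filterlim_ident])
      from filterlim_compose[OF lim[of "1 / c"] this] 3 that
      have "((\<lambda>x. l x / l (c * x)) \<longlongrightarrow> 1) at_top" by simp
      from tendsto_inverse[OF this] show ?thesis by simp
    qed
  qed
  with l show ?thesis by (auto simp: slowly_varying_def slowly_varying_rem_def)
qed

lemma measurable_ln_half_line:
  assumes "l \<in> nonneg_measurable"
  shows "(\<lambda>x. ln (l x)) \<in> borel_measurable half_line"
  using assms by (intro borel_measurable_ln) (auto simp: nonneg_measurable_def)

lemma slowly_varying_ln_ratio_tendsto:
  assumes l: "l \<in> slowly_varying" and c: "0 < c"
  shows "((\<lambda>x. ln (l (c * x)) - ln (l x)) \<longlongrightarrow> 0) at_top"
proof -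
  have "((\<lambda>x. l (c * x) / l x) \<longlongrightarrow> 1) at_top"
    using l c by (auto simp: slowly_varying_def)
  from tendsto_ln[OF this] have "((\<lambda>x. ln (l (c * x) / l x)) \<longlongrightarrow> 0) at_top" by simp
  moreover have "\<forall>\<^sub>F x in at_top. ln (l (c * x) / l x) = ln (l (c * x)) - ln (l x)"
    using slowly_varying_eventually_pos[OF l]
      eventually_at_top_scaled[OF c slowly_varying_eventually_pos[OF l]]
    by eventually_elim (simp add: ln_div)
  ultimately show ?thesis by (rule Lim_transform_eventually)
qed

section \<open>Potter-type bounds for slowly varying functions\<close>

text \<open>Potter's bound in logarithmic form. Each doubling of the argument costs at most
  \<open>\<delta> * ln 2\<close>, and the last factor, in \<open>[1,2]\<close>, costs the uniform
  constant \<open>C\<close> once.\<close>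

lemma slowly_varying_potter:
  assumes l: "l \<in> slowly_varying" and "0 < \<delta>"
  shows "\<exists>C. \<forall>\<^sub>F y in at_top. \<forall>s\<ge>1. \<bar>ln (l (s * y)) - ln (l y)\<bar> \<le> C + \<delta> * ln s"
proof -
  have small: "\<forall>\<^sub>F y in at_top. \<bar>ln (l (c * y)) - ln (l y)\<bar> \<le> e" if "0 < c" "0 < e" for c e
    using tendstoD[OF slowly_varying_ln_ratio_tendsto[OF l that(1)] that(2)]
    by eventually_elim (simp add: dist_real_def)
  \<comment> \<open>The factor 1 displays the weight \<open>G\<close> as the constant function
    1.\<close>
  have "\<exists>C. \<forall>\<^sub>F u in at_top. \<forall>v\<in>{1..2}. \<bar>ln (l (v * u)) - ln (l u)\<bar> \<le> C * 1"
  proof (rule uniform_increment_bound)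
    show "\<exists>C. \<forall>\<^sub>F u in at_top. \<bar>ln (l (c * u)) - ln (l u)\<bar> \<le> C * 1" if "c \<ge> 1" for c
      using small[of c 1] that by (intro exI[of _ 1]) auto
  qed (use l in \<open>auto simp: slowly_varying_def intro!: measurable_ln_half_line exI[of _ 1]\<close>)
  then obtain C where "\<forall>\<^sub>F u in at_top. \<forall>v\<in>{1..2}. \<bar>ln (l (v * u)) - ln (l u)\<bar> \<le> C"
    by auto
  moreover have "\<forall>\<^sub>F y in at_top. \<bar>ln (l (2 * y)) - ln (l y)\<bar> \<le> \<delta> * ln 2"
    using \<open>0 < \<delta>\<close> by (intro small) auto
  ultimately have "\<forall>\<^sub>F y in at_top. (\<forall>v\<in>{1..2}. \<bar>ln (l (v * y)) - ln (l y)\<bar> \<le> C)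
      \<and> \<bar>ln (l (2 * y)) - ln (l y)\<bar> \<le> \<delta> * ln 2"
    by eventually_elim auto
  then obtain Y where Y: "\<And>y v. y \<ge> Y \<Longrightarrow> 1 \<le> v \<Longrightarrow> v \<le> 2 \<Longrightarrow> \<bar>ln (l (v * y)) - ln (l y)\<bar> \<le> C"
      "\<And>y. y \<ge> Y \<Longrightarrow> \<bar>ln (l (2 * y)) - ln (l y)\<bar> \<le> \<delta> * ln 2"
    unfolding eventually_at_top_linorder by (metis atLeastAtMost_iff)
  have "0 \<le> C" using Y(1)[of Y 1] by simp
  \<comment> \<open>Induction on the number of doublings: \<open>s\<close> is halved while
    \<open>y\<close> is doubled. The lower bound \<open>max Y 0\<close> ensures that doubling stays
    in the range where the one-step bounds hold.\<close>
  have step: "1 \<le> s \<Longrightarrow> s \<le> 2 ^ n \<Longrightarrow> max Y 0 \<le> y \<Longrightarrow> \<bar>ln (l (s * y)) - ln (l y)\<bar> \<le> C + \<delta> * ln s"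
    for n s y
  proof (induction n arbitrary: s y)
    case 0
    then show ?case using \<open>0 \<le> C\<close> by simp
  next
    case (Suc n)
    show ?case
    proof (cases "s \<le> 2")
      case True
      then have "\<bar>ln (l (s * y)) - ln (l y)\<bar> \<le> C" using Y(1)[of y s] Suc.prems by simp
      moreover have "0 \<le> \<delta> * ln s" using Suc.prems \<open>0 < \<delta>\<close> by simp
      ultimately show ?thesis by linarith
    next
      case False
      have "\<bar>ln (l (s / 2 * (2 * y))) - ln (l (2 * y))\<bar> \<le> C + \<delta> * ln (s / 2)"
        using False Suc.prems by (intro Suc.IH) auto
      moreover have "\<bar>ln (l (2 * y)) - ln (l y)\<bar> \<le> \<delta> * ln 2" using Y(2)[of y] Suc.prems by simp
      moreover have "\<delta> * ln (s / 2) = \<delta> * ln s - \<delta> * ln 2"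
        using False by (simp add: ln_div algebra_simps)
      ultimately show ?thesis by simp
    qed
  qed
  have "\<forall>\<^sub>F y in at_top. \<forall>s\<ge>1. \<bar>ln (l (s * y)) - ln (l y)\<bar> \<le> C + \<delta> * ln s"
    using eventually_ge_at_top[of "max Y 0"]
  proof eventually_elim
    case (elim y)
    show ?case
    proof (intro allI impI)
      fix s :: real assume "1 \<le> s"
      obtain n where "s < 2 ^ n" using real_arch_pow[of 2 s] by auto
      with \<open>1 \<le> s\<close> elim show "\<bar>ln (l (s * y)) - ln (l y)\<bar> \<le> C + \<delta> * ln s"
        by (intro step[of s n]) auto
    qed
  qed
  then show ?thesis by blast
qed

text \<open>Along dyadic points the increments of \<open>ln l\<close> are at most
  \<open>C * g (2^k * y)\<close>, and \<open>g\<close> grows by at most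
  \<open>2 powr (\<delta> / 2)\<close> per doubling. The resulting geometric sum is of order
  \<open>s powr \<delta> * g y\<close>.\<close>

lemma slowly_varying_rem_ln_increment:
  assumes l: "l \<in> slowly_varying_rem g" and g: "g \<in> slowly_varying" and g0: "(g \<longlongrightarrow> 0) at_top"
    and "0 < \<delta>"
  shows "\<exists>D. \<forall>\<^sub>F y in at_top. \<forall>s\<ge>1. \<bar>ln (l (s * y)) - ln (l y)\<bar> \<le> D * s powr \<delta> * g y"
proof -
  have lsv: "l \<in> slowly_varying" by (rule slowly_varying_rem_imp_slowly_varying[OF l g0])
  note l_pos = slowly_varying_eventually_pos[OF lsv]
  note g_pos = slowly_varying_eventually_pos[OF g]
  \<comment> \<open>The exponent 1 is an arbitrary choice: this bound is applied only for factors in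
    \<open>[1,2]\<close>, where \<open>ln s \<le> ln 2\<close>.\<close>
  obtain C1 where C1: "\<forall>\<^sub>F y in at_top. \<forall>s\<ge>1. \<bar>ln (g (s * y)) - ln (g y)\<bar> \<le> C1 + 1 * ln s"
    using slowly_varying_potter[OF g, of 1] by auto
  obtain Yg where Yg: "\<And>y. y \<ge> Yg \<Longrightarrow> 0 < g y"
    using g_pos by (auto simp: eventually_at_top_linorder)
  have gK: "\<forall>\<^sub>F u in at_top. \<forall>v\<in>{1..2}. g (v * u) \<le> exp (C1 + ln 2) * g u"
    using C1 eventually_ge_at_top[of "max Yg 0"]
  proof eventually_elim
    case (elim u)
    show ?case
    proof
      fix v :: real assume v: "v \<in> {1..2}"
      have pos: "0 < g u" "0 < g (v * u)"
        using elim v mult_right_mono[of 1 v u] by (auto intro!: Yg)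
      have "ln (g (v * u)) - ln (g u) \<le> C1 + ln v" using elim v by force
      moreover have "ln v \<le> ln 2" using v by simp
      ultimately have "ln (g (v * u)) \<le> (C1 + ln 2) + ln (g u)" by linarith
      then have "exp (ln (g (v * u))) \<le> exp (C1 + ln 2 + ln (g u))" by simp
      with pos show "g (v * u) \<le> exp (C1 + ln 2) * g u" by (simp add: exp_add)
    qed
  qed
  have "\<exists>C. \<forall>\<^sub>F u in at_top. \<forall>v\<in>{1..2}. \<bar>ln (l (v * u)) - ln (l u)\<bar> \<le> C * g u"
  proof (rule uniform_increment_bound[OF measurable_ln_half_line _ _ gK])
    show "l \<in> nonneg_measurable" using l by (auto simp: slowly_varying_rem_def)
    show "\<forall>\<^sub>F u in at_top. 0 \<le> g u" using g_pos by eventually_elim simp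
    show "\<exists>C. \<forall>\<^sub>F u in at_top. \<bar>ln (l (c * u)) - ln (l u)\<bar> \<le> C * g u" if "c \<ge> 1" for c
    proof (cases "c = 1")
      case True
      then show ?thesis by (intro exI[of _ 0]) auto
    next
      case False
      with that have "c > 1" by simp
      then have "(\<lambda>x. l (c * x) / l x - 1) \<in> O[at_top](g)"
        using l by (auto simp: slowly_varying_rem_def)
      then obtain k where k: "\<forall>\<^sub>F x in at_top. norm (l (c * x) / l x - 1) \<le> k * norm (g x)"
        by (elim landau_o.bigE)
      have "((\<lambda>x. l (c * x) / l x) \<longlongrightarrow> 1) at_top"
        using lsv \<open>c > 1\<close> by (auto simp: slowly_varying_def)
      then have "\<forall>\<^sub>F x in at_top. dist (l (c * x) / l x) 1 < 1 / 2" by (rule tendstoD) simp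
      moreover have "\<forall>\<^sub>F x in at_top. 0 < l (c * x)"
        using \<open>c > 1\<close> l_pos by (intro eventually_at_top_scaled) auto
      ultimately have "\<forall>\<^sub>F u in at_top. \<bar>ln (l (c * u)) - ln (l u)\<bar> \<le> (2 * k) * g u"
        using k l_pos g_pos
      proof eventually_elim
        case (elim u)
        then have "\<bar>ln (l (c * u)) - ln (l u)\<bar> \<le> 2 * \<bar>l (c * u) / l u - 1\<bar>"
          by (intro abs_ln_diff_le) (auto simp: dist_real_def)
        with elim show ?case by auto
      qed
      then show ?thesis by blast
    qed
  qed
  then obtain C where C: "\<forall>\<^sub>F u in at_top. \<forall>v\<in>{1..2}. \<bar>ln (l (v * u)) - ln (l u)\<bar> \<le> C * g u" by blast
  \<comment> \<open>Per doubling, \<open>g\<close> may gain \<open>2 powr (\<delta> / 2)\<close>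
    while halving \<open>s\<close> saves \<open>2 powr \<delta>\<close>; \<open>p\<close> is the
    resulting contraction factor.\<close>
  define p where "p = 2 powr (- \<delta> / 2)"
  have p: "0 < p" "p < 1" using \<open>0 < \<delta>\<close> by (auto simp: p_def powr_less_one)
  have "((\<lambda>x. g (2 * x) / g x) \<longlongrightarrow> 1) at_top" using g by (auto simp: slowly_varying_def)
  then have "\<forall>\<^sub>F x in at_top. g (2 * x) / g x < 2 powr (\<delta> / 2)"
    using \<open>0 < \<delta>\<close> by (intro order_tendstoD(2)) auto
  with C have "\<forall>\<^sub>F y in at_top. (\<forall>v\<in>{1..2}. \<bar>ln (l (v * y)) - ln (l y)\<bar> \<le> C * g y)
      \<and> g (2 * y) \<le> 2 powr (\<delta> / 2) * g y \<and> 0 < g y"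
    using g_pos by eventually_elim (auto simp: field_simps)
  then obtain Y where Y: "\<And>y v. y \<ge> Y \<Longrightarrow> 1 \<le> v \<Longrightarrow> v \<le> 2 \<Longrightarrow> \<bar>ln (l (v * y)) - ln (l y)\<bar> \<le> C * g y"
      "\<And>y. y \<ge> Y \<Longrightarrow> g (2 * y) \<le> 2 powr (\<delta> / 2) * g y" "\<And>y. y \<ge> Y \<Longrightarrow> 0 < g y"
    unfolding eventually_at_top_linorder by (metis atLeastAtMost_iff)
  have "0 \<le> C" using Y(1)[of Y 1] Y(3)[of Y] by (simp add: zero_le_mult_iff)
  \<comment> \<open>\<open>D\<close> solves \<open>D = D * p + C\<close>, so that the bound is preserved when \<open>s\<close> doubles.\<close>
  define D where "D = C / (1 - p)"
  have D: "C = D * (1 - p)" "0 \<le> D" "C \<le> D"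
    using p \<open>0 \<le> C\<close> by (auto simp: D_def field_simps)
  have step: "1 \<le> s \<Longrightarrow> s \<le> 2 ^ n \<Longrightarrow> max Y 0 \<le> y \<Longrightarrow> \<bar>ln (l (s * y)) - ln (l y)\<bar> \<le> D * s powr \<delta> * g y"
    for n s y
  proof (induction n arbitrary: s y)
    case 0
    then show ?case using D Y(3)[of y] by simp
  next
    case (Suc n)
    have gy: "0 < g y" using Y(3)[of y] Suc.prems by simp
    have s1: "1 \<le> s powr \<delta>" using Suc.prems \<open>0 < \<delta>\<close> by (simp add: ge_one_powr_ge_zero)
    show ?case
    proof (cases "s \<le> 2")
      case True
      then have "\<bar>ln (l (s * y)) - ln (l y)\<bar> \<le> C * g y" using Y(1)[of y s] Suc.prems by simp
      also have "\<dots> \<le> D * s powr \<delta> * g y"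
        using mult_mono[OF D(3) s1] D gy by (intro mult_right_mono) auto
      finally show ?thesis .
    next
      case False
      have "\<bar>ln (l (s / 2 * (2 * y))) - ln (l (2 * y))\<bar> \<le> D * (s / 2) powr \<delta> * g (2 * y)"
        using False Suc.prems by (intro Suc.IH) auto
      also have "\<dots> \<le> D * (s / 2) powr \<delta> * (2 powr (\<delta> / 2) * g y)"
        using D Y(2)[of y] Suc.prems by (intro mult_left_mono) auto
      also have "\<dots> = D * s powr \<delta> * p * g y"
      proof -
        have "2 powr (\<delta> / 2) / 2 powr \<delta> = p"
          unfolding p_def by (simp add: powr_diff[symmetric])
        then show ?thesis using False by (simp add: powr_divide field_simps)
      qed
      finally have "\<bar>ln (l (s * y)) - ln (l (2 * y))\<bar> \<le> D * s powr \<delta> * p * g y" by simp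
      moreover have "\<bar>ln (l (2 * y)) - ln (l y)\<bar> \<le> C * g y" using Y(1)[of y 2] Suc.prems by simp
      moreover have "C * g y \<le> D * (1 - p) * s powr \<delta> * g y"
        using mult_mono[of C C 1 "s powr \<delta>"] s1 \<open>0 \<le> C\<close> gy D(1) by (intro mult_right_mono) auto
      moreover have "D * (1 - p) * s powr \<delta> * g y = D * s powr \<delta> * g y - D * s powr \<delta> * p * g y"
        by (simp add: algebra_simps)
      ultimately show ?thesis by linarith
    qed
  qed
  have "\<forall>\<^sub>F y in at_top. \<forall>s\<ge>1. \<bar>ln (l (s * y)) - ln (l y)\<bar> \<le> D * s powr \<delta> * g y"
    using eventually_ge_at_top[of "max Y 0"]
  proof eventually_elim
    case (elim y)
    show ?case
    proof (intro allI impI)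
      fix s :: real assume "1 \<le> s"
      obtain n where "s < 2 ^ n" using real_arch_pow[of 2 s] by auto
      with \<open>1 \<le> s\<close> elim show "\<bar>ln (l (s * y)) - ln (l y)\<bar> \<le> D * s powr \<delta> * g y"
        by (intro step[of s n]) auto
    qed
  qed
  then show ?thesis by blast
qed

text \<open>Increments are always measured from the smaller of the two points. If that is
  \<open>z\<close>, the error comes out in terms of \<open>g z\<close>, and Potter's bound for
  \<open>g\<close> trades it for \<open>g y\<close> at the price of a further power.\<close>

lemma slowly_varying_rem_ratio_bound:
  assumes l: "l \<in> slowly_varying_rem g" and g: "g \<in> slowly_varying" and g0: "(g \<longlongrightarrow> 0) at_top"
    and "0 < \<epsilon>"
  shows "\<exists>K\<ge>0. \<exists>Y>0. \<forall>y\<ge>Y. \<forall>z\<ge>Y. \<bar>l z / l y - 1\<bar> \<le> K * g y * ((z / y) powr \<epsilon> + (z / y) powr - \<epsilon>)"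
proof -
  \<comment> \<open>Three powers \<open>s powr \<delta>\<close> accumulate: from the increment of
    \<open>ln l\<close>, from exponentiating Potter's bound for \<open>l\<close>, and from
    exchanging \<open>g z\<close> for \<open>g y\<close>.\<close>
  define \<delta> where "\<delta> = \<epsilon> / 3"
  have "0 < \<delta>" using \<open>0 < \<epsilon>\<close> by (simp add: \<delta>_def)
  have lsv: "l \<in> slowly_varying" by (rule slowly_varying_rem_imp_slowly_varying[OF l g0])
  obtain C1 where C1: "\<forall>\<^sub>F y in at_top. \<forall>s\<ge>1. \<bar>ln (l (s * y)) - ln (l y)\<bar> \<le> C1 + \<delta> * ln s"
    using slowly_varying_potter[OF lsv \<open>0 < \<delta>\<close>] by blast
  obtain C2 where C2: "\<forall>\<^sub>F y in at_top. \<forall>s\<ge>1. \<bar>ln (g (s * y)) - ln (g y)\<bar> \<le> C2 + \<delta> * ln s"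
    using slowly_varying_potter[OF g \<open>0 < \<delta>\<close>] by blast
  obtain D where D: "\<forall>\<^sub>F y in at_top. \<forall>s\<ge>1. \<bar>ln (l (s * y)) - ln (l y)\<bar> \<le> D * s powr \<delta> * g y"
    using slowly_varying_rem_ln_increment[OF l g g0 \<open>0 < \<delta>\<close>] by blast
  have "\<forall>\<^sub>F y in at_top. 0 < y \<and> 0 < l y \<and> 0 < g y
      \<and> (\<forall>s\<ge>1. \<bar>ln (l (s * y)) - ln (l y)\<bar> \<le> C1 + \<delta> * ln s)
      \<and> (\<forall>s\<ge>1. \<bar>ln (g (s * y)) - ln (g y)\<bar> \<le> C2 + \<delta> * ln s)
      \<and> (\<forall>s\<ge>1. \<bar>ln (l (s * y)) - ln (l y)\<bar> \<le> D * s powr \<delta> * g y)"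
    using C1 C2 D slowly_varying_eventually_pos[OF lsv] slowly_varying_eventually_pos[OF g]
      eventually_gt_at_top[of "0::real"]
    by eventually_elim auto
  then obtain Y0 where Y0: "\<And>y. y \<ge> Y0 \<Longrightarrow> 0 < y \<and> 0 < l y \<and> 0 < g y
      \<and> (\<forall>s\<ge>1. \<bar>ln (l (s * y)) - ln (l y)\<bar> \<le> C1 + \<delta> * ln s)
      \<and> (\<forall>s\<ge>1. \<bar>ln (g (s * y)) - ln (g y)\<bar> \<le> C2 + \<delta> * ln s)
      \<and> (\<forall>s\<ge>1. \<bar>ln (l (s * y)) - ln (l y)\<bar> \<le> D * s powr \<delta> * g y)"
    by (auto simp: eventually_at_top_linorder)
  have Ypos: "0 < Y0" using Y0[of Y0] by simp
  \<comment> \<open>At \<open>s = 1\<close> the increments vanish, so the bounds themselves force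
    \<open>D\<close> and \<open>C2\<close> to be nonnegative.\<close>
  have "0 \<le> D * g Y0" using Y0[of Y0] by force
  then have D0: "0 \<le> D" using Y0[of Y0] by (simp add: zero_le_mult_iff)
  have "0 \<le> C2" using Y0[of Y0] by force
  define K where "K = D * exp (C1 + C2)"
  \<comment> \<open>In \<open>|t| * exp |t|\<close> the first factor takes the bound containing
    \<open>g\<close>, the second Potter's bound, so that the exponential is only a power of
    \<open>s\<close>. Only \<open>|t|\<close> is prescribed, since the sign depends on which point
    is smaller.\<close>
  have increment: "\<bar>exp t - 1\<bar> \<le> D * exp C1 * s powr (2 * \<delta>) * g w"
    if "w \<ge> Y0" "s \<ge> 1" "\<bar>t\<bar> = \<bar>ln (l (s * w)) - ln (l w)\<bar>" for t s w
  proof -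
    have "\<bar>t\<bar> \<le> D * s powr \<delta> * g w" "\<bar>t\<bar> \<le> C1 + \<delta> * ln s" and gw: "0 < g w"
      using Y0[OF that(1)] that by auto
    then have "\<bar>t\<bar> * exp \<bar>t\<bar> \<le> (D * s powr \<delta> * g w) * exp (C1 + \<delta> * ln s)"
      using D0 by (intro mult_mono) auto
    also have "\<dots> = D * exp C1 * (s powr \<delta> * s powr \<delta>) * g w"
      using that by (simp add: exp_add powr_def)
    also have "s powr \<delta> * s powr \<delta> = s powr (2 * \<delta>)" by (simp flip: powr_add)
    finally show ?thesis using abs_exp_minus_one_le[of t] by linarith
  qed
  have "\<bar>l z / l y - 1\<bar> \<le> K * g y * ((z / y) powr \<epsilon> + (z / y) powr - \<epsilon>)" if yz: "y \<ge> Y0" "z \<ge> Y0" for y z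
  proof -
    have pos: "0 < y" "0 < z" "0 < l y" "0 < l z" "0 < g y" "0 < g z"
      using Y0[of y] Y0[of z] yz by auto
    define t where "t = ln (l z) - ln (l y)"
    have t: "l z / l y = exp t" using pos by (simp add: t_def exp_diff)
    have K0: "0 \<le> K" using D0 by (simp add: K_def)
    show ?thesis
    proof (cases "z \<ge> y")
      case True
      define s where "s = z / y"
      have s: "s \<ge> 1" "s * y = z" using True pos by (auto simp: s_def)
      have "\<bar>l z / l y - 1\<bar> \<le> D * exp C1 * s powr (2 * \<delta>) * g y"
        unfolding t by (rule increment[OF yz(1) s(1)]) (simp add: t_def s)
      also have "\<dots> \<le> K * s powr \<epsilon> * g y"
        unfolding K_def using \<open>0 \<le> C2\<close> D0 s \<open>0 < \<epsilon>\<close> pos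
        by (intro mult_mono powr_mono) (auto simp: \<delta>_def)
      also have "\<dots> \<le> K * g y * (s powr \<epsilon> + s powr - \<epsilon>)"
        using K0 pos by (simp add: algebra_simps)
      finally show ?thesis by (simp add: s_def)
    next
      case False
      define s where "s = y / z"
      have s: "s \<ge> 1" "s * z = y" using False pos by (auto simp: s_def)
      have "ln (g z) - ln (g y) \<le> C2 + \<delta> * ln s"
        using Y0[OF yz(2)] s by fastforce
      then have "exp (ln (g z)) \<le> exp (C2 + \<delta> * ln s + ln (g y))" by simp
      then have gz: "g z \<le> exp C2 * s powr \<delta> * g y"
        using pos s by (simp add: exp_add powr_def)
      have "\<bar>l z / l y - 1\<bar> \<le> D * exp C1 * s powr (2 * \<delta>) * g z"
        unfolding t by (rule increment[OF yz(2) s(1)]) (simp add: t_def s)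
      also have "\<dots> \<le> D * exp C1 * s powr (2 * \<delta>) * (exp C2 * s powr \<delta> * g y)"
        using gz D0 by (intro mult_left_mono) auto
      also have "\<dots> = K * (s powr (2 * \<delta>) * s powr \<delta>) * g y"
        by (simp add: K_def exp_add)
      also have "s powr (2 * \<delta>) * s powr \<delta> = s powr \<epsilon>"
        by (simp add: \<delta>_def flip: powr_add)
      also have "K * s powr \<epsilon> * g y \<le> K * g y * (s powr - \<epsilon> + s powr \<epsilon>)"
        using K0 pos by (simp add: algebra_simps)
      also have "s powr - \<epsilon> = (z / y) powr \<epsilon>"
        using pos by (simp add: s_def powr_minus powr_divide)
      also have "s powr \<epsilon> = (z / y) powr - \<epsilon>"
        using pos by (simp add: s_def powr_minus powr_divide)
      finally show ?thesis .
    qed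
  qed
  moreover have "0 \<le> K" using D0 by (simp add: K_def)
  ultimately show ?thesis using Ypos by blast
qed

section \<open>Comparison with powers and the Zygmund class\<close>

text \<open>Potter's bound from a fixed base point \<open>Y\<close> to \<open>y\<close> limits how
  fast \<open>l\<close> can decay.\<close>

lemma slowly_varying_dominates_negative_powr:
  assumes l: "l \<in> slowly_varying" and "0 < \<epsilon>"
  shows "\<exists>K\<ge>0. \<forall>\<^sub>F y in at_top. y powr (- \<epsilon>) \<le> K * l y"
proof -
  obtain C where C: "\<forall>\<^sub>F y in at_top. \<forall>s\<ge>1. \<bar>ln (l (s * y)) - ln (l y)\<bar> \<le> C + \<epsilon> * ln s"
    using slowly_varying_potter[OF assms] by blast
  have "\<forall>\<^sub>F y in at_top. 0 < y \<and> 0 < l y \<and> (\<forall>s\<ge>1. \<bar>ln (l (s * y)) - ln (l y)\<bar> \<le> C + \<epsilon> * ln s)"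
    using C slowly_varying_eventually_pos[OF l] eventually_gt_at_top[of "0::real"]
    by eventually_elim auto
  then obtain Y where Y: "\<And>y. y \<ge> Y \<Longrightarrow> 0 < y \<and> 0 < l y \<and> (\<forall>s\<ge>1. \<bar>ln (l (s * y)) - ln (l y)\<bar> \<le> C + \<epsilon> * ln s)"
    by (auto simp: eventually_at_top_linorder)
  define k where "k = C - ln (l Y) - \<epsilon> * ln Y"
  have "y powr (- \<epsilon>) \<le> exp k * l y" if "y \<ge> Y" for y
  proof -
    have pos: "0 < y" "0 < Y" "0 < l y" using Y[of Y] Y[of y] that by auto
    then have "\<bar>ln (l (y / Y * Y)) - ln (l Y)\<bar> \<le> C + \<epsilon> * ln (y / Y)"
      using Y[of Y] that by (intro Y[THEN conjunct2, THEN conjunct2, rule_format]) auto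
    then have "\<bar>ln (l y) - ln (l Y)\<bar> \<le> C + \<epsilon> * (ln y - ln Y)"
      using pos by (simp add: ln_div)
    then have "- \<epsilon> * ln y \<le> k + ln (l y)" by (simp add: k_def algebra_simps abs_le_iff)
    then have "exp (- \<epsilon> * ln y) \<le> exp (k + ln (l y))" by simp
    with pos show ?thesis by (simp add: exp_add powr_def)
  qed
  then have "\<forall>\<^sub>F y in at_top. y powr (- \<epsilon>) \<le> exp k * l y"
    by (auto simp: eventually_at_top_linorder)
  then show ?thesis by (intro exI[of _ "exp k"]) auto
qed

text \<open>For \<open>z \<ge> y\<close> the decrease of \<open>x powr (- \<epsilon>) * h x\<close>
  gives the first power, for \<open>z < y\<close> the increase of
  \<open>x powr \<epsilon> * h x\<close> gives the second.\<close>

lemma zygmund_ratio_bound: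
  assumes h: "h \<in> zygmund" and "0 < \<epsilon>"
  shows "\<exists>Y>0. \<forall>y\<ge>Y. \<forall>z\<ge>Y. h z \<le> h y * ((z / y) powr \<epsilon> + (z / y) powr - \<epsilon>)"
proof -
  obtain X1 X2 where X: "0 < X1" "mono_on {X1<..} (\<lambda>x. x powr \<epsilon> * h x)"
      "0 < X2" "antimono_on {X2<..} (\<lambda>x. x powr (- \<epsilon>) * h x)"
    using assms by (auto simp: zygmund_def)
  have "h z \<le> h y * ((z / y) powr \<epsilon> + (z / y) powr - \<epsilon>)"
    if yz: "y \<ge> X1 + X2" "z \<ge> X1 + X2" for y z
  proof -
    have pos: "0 < y" "0 < z" "X1 < y" "X1 < z" "X2 < y" "X2 < z" using X yz by auto
    then have h0: "0 \<le> h y" using h by (auto simp: zygmund_def nonneg_measurable_def)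
    show ?thesis
    proof (cases "z \<ge> y")
      case True
      then have "z powr (- \<epsilon>) * h z \<le> y powr (- \<epsilon>) * h y"
        using monotone_onD[OF X(4), of y z] pos by auto
      then have "h z \<le> h y * (z / y) powr \<epsilon>"
        using pos by (simp add: powr_minus powr_divide field_simps)
      also have "\<dots> \<le> h y * ((z / y) powr \<epsilon> + (z / y) powr - \<epsilon>)"
        using h0 by (intro mult_left_mono) auto
      finally show ?thesis .
    next
      case False
      then have "z powr \<epsilon> * h z \<le> y powr \<epsilon> * h y"
        using monotone_onD[OF X(2), of z y] pos by auto
      then have "h z \<le> h y * (z / y) powr - \<epsilon>"
        using pos by (simp add: powr_minus powr_divide field_simps)
      also have "\<dots> \<le> h y * ((z / y) powr \<epsilon> + (z / y) powr - \<epsilon>)"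
        using h0 by (intro mult_left_mono) auto
      finally show ?thesis .
    qed
  qed
  with X show ?thesis by (intro exI[of _ "X1 + X2"]) auto
qed

text \<open>Reduces every exponent in the strip to the two endpoints, whose weights are integrable
  against \<open>|U s| / s\<close>.\<close>

lemma powr_le_add_powr:
  fixes s :: real
  assumes "0 < s" "a \<le> e" "e \<le> b"
  shows "s powr e \<le> s powr a + s powr b"
proof (cases "s \<ge> 1")
  case True
  then have "s powr e \<le> s powr b" using assms by (intro powr_mono) auto
  then show ?thesis by (smt (verit) powr_ge_zero)
next
  case False
  then have "s powr e \<le> s powr a" using assms by (intro powr_mono') auto
  then show ?thesis by (smt (verit) powr_ge_zero)
qed

section \<open>Uniform estimate for the rescaled kernel\<close>

text \<open>The bound separates variables: \<open>y\<close> enters through \<open>g y + h y\<close>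
  alone and \<open>s\<close> through an integrable weight. The proof splits at
  \<open>y * s = Y\<close>, the threshold for the asymptotic formula.\<close>

lemma mellin_kernel_error_bound:
  fixes f l g h :: "real \<Rightarrow> real"
  assumes "\<sigma> < \<rho>" and "\<rho> < \<tau>"
    and g: "g \<in> slowly_varying" and g0: "(g \<longlongrightarrow> 0) at_top"
    and l: "l \<in> slowly_varying_rem g"
    and h: "h \<in> zygmund"
    and E: "E \<in> O[at_top](h)"
    and f: "\<forall>\<^sub>F y in at_top. f (inverse y) = y powr (- \<rho>) * l y * (1 + E y)"
    and f_bdd: "\<And>a. 0 < a \<Longrightarrow> bounded ((\<lambda>y. y powr \<tau> * f (inverse y)) ` {0<..a})"
  shows "\<exists>K. \<forall>\<^sub>F y in at_top. \<forall>s>0. \<bar>f (inverse (y * s)) / (y powr (- \<rho>) * l y) - s powr (- \<rho>)\<bar>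
           \<le> K * (g y + h y) * (s powr (- \<sigma>) + s powr (- \<tau>))"
proof -
  \<comment> \<open>The product of two Potter factors occurs below, so
    \<open>- \<rho> + 2 * \<epsilon>\<close> and \<open>- \<rho> - 2 * \<epsilon>\<close> must stay
    between \<open>- \<tau>\<close> and \<open>- \<sigma>\<close>.\<close>
  define \<epsilon> where "\<epsilon> = min (\<rho> - \<sigma>) (\<tau> - \<rho>) / 2"
  have \<epsilon>: "0 < \<epsilon>" "2 * \<epsilon> \<le> \<rho> - \<sigma>" "2 * \<epsilon> \<le> \<tau> - \<rho>"
    using assms(1,2) by (auto simp: \<epsilon>_def)
  \<comment> \<open>For \<open>y * s < Y\<close> a factor \<open>y powr (- d)\<close> is gained. In
    the term with \<open>f\<close> half of it pays for \<open>1 / l y\<close> and half for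
    \<open>g y\<close> (\<open>K2\<close>, \<open>K3\<close>); in the term
    \<open>s powr (- \<rho>)\<close> all of it pays for \<open>g y\<close>
    (\<open>K4\<close>).\<close>
  define d where "d = \<tau> - \<rho>"
  have d: "0 < d" using assms(2) by (simp add: d_def)
  have lsv: "l \<in> slowly_varying" by (rule slowly_varying_rem_imp_slowly_varying[OF l g0])
  obtain K1 Y1 where K1: "0 \<le> K1" "\<And>y z. y \<ge> Y1 \<Longrightarrow> z \<ge> Y1 \<Longrightarrow>
      \<bar>l z / l y - 1\<bar> \<le> K1 * g y * ((z / y) powr \<epsilon> + (z / y) powr - \<epsilon>)"
    using slowly_varying_rem_ratio_bound[OF l g g0 \<epsilon>(1)] by blast
  obtain Y2 where Y2: "\<And>y z. y \<ge> Y2 \<Longrightarrow> z \<ge> Y2 \<Longrightarrow> h z \<le> h y * ((z / y) powr \<epsilon> + (z / y) powr - \<epsilon>)"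
    using zygmund_ratio_bound[OF h \<epsilon>(1)] by blast
  obtain K2 where K2: "0 \<le> K2" "\<forall>\<^sub>F y in at_top. y powr (- (d / 2)) \<le> K2 * l y"
    using slowly_varying_dominates_negative_powr[OF lsv, of "d / 2"] d by auto
  obtain K3 where K3: "0 \<le> K3" "\<forall>\<^sub>F y in at_top. y powr (- (d / 2)) \<le> K3 * g y"
    using slowly_varying_dominates_negative_powr[OF g, of "d / 2"] d by auto
  obtain K4 where K4: "0 \<le> K4" "\<forall>\<^sub>F y in at_top. y powr (- d) \<le> K4 * g y"
    using slowly_varying_dominates_negative_powr[OF g d] by auto
  obtain k where k: "0 < k" "\<forall>\<^sub>F y in at_top. norm (E y) \<le> k * norm (h y)"
    using E by (elim landau_o.bigE)
  have "\<forall>\<^sub>F y in at_top. g y < 1" using g0 by (rule order_tendstoD) simp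
  then have "\<forall>\<^sub>F y in at_top. y \<ge> Y1 \<and> y \<ge> Y2 \<and> 0 < y \<and> 0 < l y \<and> 0 < g y \<and> g y < 1
      \<and> y powr (- (d / 2)) \<le> K2 * l y \<and> y powr (- (d / 2)) \<le> K3 * g y \<and> y powr (- d) \<le> K4 * g y
      \<and> norm (E y) \<le> k * norm (h y) \<and> f (inverse y) = y powr (- \<rho>) * l y * (1 + E y)"
    using K2(2) K3(2) K4(2) k(2) f slowly_varying_eventually_pos[OF lsv] slowly_varying_eventually_pos[OF g]
      eventually_gt_at_top[of "0::real"] eventually_ge_at_top[of Y1] eventually_ge_at_top[of Y2]
    by eventually_elim auto
  then obtain Y where Y: "\<And>y. y \<ge> Y \<Longrightarrow> y \<ge> Y1 \<and> y \<ge> Y2 \<and> 0 < y \<and> 0 < l y \<and> 0 < g y \<and> g y < 1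
      \<and> y powr (- (d / 2)) \<le> K2 * l y \<and> y powr (- (d / 2)) \<le> K3 * g y \<and> y powr (- d) \<le> K4 * g y
      \<and> norm (E y) \<le> k * norm (h y) \<and> f (inverse y) = y powr (- \<rho>) * l y * (1 + E y)"
    unfolding eventually_at_top_linorder by blast
  have "0 < Y" using Y[of Y] by simp
  then obtain B where B: "\<And>z. 0 < z \<Longrightarrow> z \<le> Y \<Longrightarrow> \<bar>z powr \<tau> * f (inverse z)\<bar> \<le> B"
    using f_bdd[of Y] by (fastforce simp: bounded_iff)
  have "0 \<le> B" using B[of Y] \<open>0 < Y\<close> by linarith
  have h_nonneg: "0 \<le> h y" if "0 < y" for y
    using h that by (auto simp: zygmund_def nonneg_measurable_def)
  \<comment> \<open>The first entry serves \<open>y * s \<ge> Y\<close>, the second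
    \<open>y * s < Y\<close>.\<close>
  define K where "K = max (4 * (K1 + (1 + K1) * k)) (B * K2 * K3 + Y powr d * K4)"
  have "\<bar>f (inverse (y * s)) / (y powr (- \<rho>) * l y) - s powr (- \<rho>)\<bar>
         \<le> K * (g y + h y) * (s powr (- \<sigma>) + s powr (- \<tau>))" if y: "y \<ge> Y" and s: "0 < s" for y s
  proof -
    note Yy = Y[OF y]
    have ypos: "0 < y" "0 < l y" "0 < g y" "0 \<le> h y" using Yy h_nonneg[of y] by auto
    define z where "z = y * s"
    have z: "0 < z" "z / y = s" using ypos s by (auto simp: z_def)
    let ?w = "s powr (- \<sigma>) + s powr (- \<tau>)"
    show ?thesis
    proof (cases "z \<ge> Y")
      case True
      note Yz = Y[OF True]
      define q where "q = s powr \<epsilon> + s powr - \<epsilon>"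
      have q1: "1 \<le> q"
        using powr_le_add_powr[of s "- \<epsilon>" 0 \<epsilon>] s \<epsilon>(1) by (simp add: q_def)
      have ratio: "\<bar>l z / l y - 1\<bar> \<le> K1 * g y * q"
        using K1(2)[of y z] Yy Yz by (simp add: z q_def)
      \<comment> \<open>Using \<open>g y < 1\<close> gives a bound on \<open>l z / l y\<close> free
        of \<open>g\<close>, so the product with \<open>E z\<close> stays linear in
        \<open>h y\<close>.\<close>
      have "K1 * g y * q \<le> K1 * 1 * q" using Yy K1(1) q1 by (intro mult_mono) auto
      then have "\<bar>l z / l y\<bar> \<le> 1 + K1 * q" using ratio by linarith
      also have "\<dots> \<le> (1 + K1) * q" using q1 by (simp add: algebra_simps)
      finally have ratio': "\<bar>l z / l y\<bar> \<le> (1 + K1) * q" .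
      have "\<bar>E z\<bar> \<le> k * h z" using Yz h_nonneg[of z] by auto
      also have "\<dots> \<le> k * (h y * q)"
        using Y2[of y z] Yy Yz k(1) by (intro mult_left_mono) (auto simp: z q_def)
      finally have Ez: "\<bar>E z\<bar> \<le> k * (h y * q)" .
      have qq: "q \<le> q\<^sup>2" using q1 by (simp add: power2_eq_square)
      have "\<bar>l z / l y * (1 + E z) - 1\<bar> \<le> \<bar>l z / l y - 1\<bar> + \<bar>l z / l y\<bar> * \<bar>E z\<bar>"
        using abs_triangle_ineq[of "l z / l y - 1" "l z / l y * E z"]
        by (simp only: abs_mult) (simp add: algebra_simps add_divide_distrib)
      also have "\<dots> \<le> K1 * g y * q + ((1 + K1) * q) * (k * (h y * q))"
        using ratio ratio' Ez K1(1) q1 by (intro add_mono mult_mono) auto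
      also have "\<dots> \<le> K1 * g y * q\<^sup>2 + (1 + K1) * k * h y * q\<^sup>2"
        using mult_left_mono[OF qq, of "K1 * g y"] K1(1) ypos by (simp add: power2_eq_square algebra_simps)
      also have "\<dots> = (K1 * g y + (1 + K1) * k * h y) * q\<^sup>2"
        by (simp add: algebra_simps)
      also have "\<dots> \<le> (K1 + (1 + K1) * k) * (g y + h y) * q\<^sup>2"
      proof (intro mult_right_mono)
        have "0 \<le> K1 * h y" "0 \<le> ((1 + K1) * k) * g y" using K1(1) k(1) ypos by auto
        then show "K1 * g y + (1 + K1) * k * h y \<le> (K1 + (1 + K1) * k) * (g y + h y)"
          by (simp only: distrib_left distrib_right)
      qed simp
      finally have main: "\<bar>l z / l y * (1 + E z) - 1\<bar> \<le> (K1 + (1 + K1) * k) * (g y + h y) * q\<^sup>2" .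
      \<comment> \<open>The square yields three powers with coefficients 1, 2, 1, each at most the
        endpoint weight; this is the source of the factor 4.\<close>
      have "s powr (- \<rho>) * q\<^sup>2 = s powr (- \<rho> + 2 * \<epsilon>) + 2 * s powr (- \<rho>) + s powr (- \<rho> - 2 * \<epsilon>)"
        using s by (simp add: q_def power2_eq_square algebra_simps powr_add[symmetric] flip: powr_add)
      also have "\<dots> \<le> (s powr (- \<tau>) + s powr (- \<sigma>)) + 2 * (s powr (- \<tau>) + s powr (- \<sigma>))
          + (s powr (- \<tau>) + s powr (- \<sigma>))"
        using s \<epsilon> assms(1,2) by (intro add_mono mult_left_mono powr_le_add_powr) auto
      finally have w: "s powr (- \<rho>) * q\<^sup>2 \<le> 4 * ?w" by simp
      have "f (inverse z) = y powr (- \<rho>) * s powr (- \<rho>) * l z * (1 + E z)"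
        using Yz ypos s by (simp add: z_def powr_mult)
      then have "f (inverse z) / (y powr (- \<rho>) * l y) - s powr (- \<rho>)
          = s powr (- \<rho>) * (l z / l y * (1 + E z) - 1)"
        using ypos by (simp add: field_simps)
      then have "\<bar>f (inverse z) / (y powr (- \<rho>) * l y) - s powr (- \<rho>)\<bar>
          = s powr (- \<rho>) * \<bar>l z / l y * (1 + E z) - 1\<bar>"
        by (simp add: abs_mult)
      also have "\<dots> \<le> s powr (- \<rho>) * ((K1 + (1 + K1) * k) * (g y + h y) * q\<^sup>2)"
        using main by (intro mult_left_mono) auto
      also have "\<dots> = (K1 + (1 + K1) * k) * (g y + h y) * (s powr (- \<rho>) * q\<^sup>2)" by simp
      also have "\<dots> \<le> (K1 + (1 + K1) * k) * (g y + h y) * (4 * ?w)"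
        using w K1(1) k(1) ypos by (intro mult_left_mono) auto
      also have "\<dots> = 4 * (K1 + (1 + K1) * k) * (g y + h y) * ?w" by (simp only: mult_ac)
      also have "\<dots> \<le> K * (g y + h y) * ?w"
        using ypos by (intro mult_right_mono) (auto simp: K_def)
      finally show ?thesis by (simp add: z_def)
    next
      case False
      \<comment> \<open>Below the threshold the two terms of the difference are bounded separately;
        no cancellation is used.\<close>
      have yd: "y powr (- d) \<le> K2 * l y * (K3 * g y)"
      proof -
        have "y powr (- d) = y powr (- (d / 2)) * y powr (- (d / 2))" by (simp flip: powr_add)
        also have "\<dots> \<le> K2 * l y * (K3 * g y)" using Yy K2(1) by (intro mult_mono) auto
        finally show ?thesis .
      qed
      have "\<bar>f (inverse z)\<bar> \<le> B * z powr (- \<tau>)"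
        using B[of z] z False by (simp add: abs_mult powr_minus field_simps)
      then have "\<bar>f (inverse z) / (y powr (- \<rho>) * l y)\<bar> \<le> B * z powr (- \<tau>) / (y powr (- \<rho>) * l y)"
        using ypos by (simp add: abs_mult divide_right_mono)
      also have "\<dots> = B * s powr (- \<tau>) * (y powr (- d) / l y)"
        using ypos s by (simp add: z_def d_def powr_mult powr_minus powr_diff field_simps)
      also have "\<dots> \<le> B * s powr (- \<tau>) * (K2 * (K3 * g y))"
        using yd ypos \<open>0 \<le> B\<close> by (intro mult_left_mono) (auto simp: field_simps)
      finally have 1: "\<bar>f (inverse z) / (y powr (- \<rho>) * l y)\<bar> \<le> B * K2 * K3 * g y * s powr (- \<tau>)"
        by (simp add: mult_ac)
      \<comment> \<open>Here \<open>s < Y / y\<close>, so the surplus factor \<open>s powr d\<close>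
        is itself small in \<open>y\<close>.\<close>
      have "s powr (- \<rho>) = s powr d * s powr (- \<tau>)" by (simp add: d_def flip: powr_add)
      also have "\<dots> \<le> (Y / y) powr d * s powr (- \<tau>)"
        using False ypos s d by (intro mult_right_mono powr_mono2) (auto simp: z_def field_simps)
      also have "\<dots> = Y powr d * y powr (- d) * s powr (- \<tau>)"
        using ypos \<open>0 < Y\<close> by (simp add: powr_divide powr_minus field_simps)
      also have "\<dots> \<le> Y powr d * (K4 * g y) * s powr (- \<tau>)"
        using Yy by (intro mult_right_mono mult_left_mono) auto
      finally have 2: "s powr (- \<rho>) \<le> Y powr d * K4 * g y * s powr (- \<tau>)" by simp
      have "\<bar>f (inverse z) / (y powr (- \<rho>) * l y) - s powr (- \<rho>)\<bar>
          \<le> \<bar>f (inverse z) / (y powr (- \<rho>) * l y)\<bar> + s powr (- \<rho>)"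
        using abs_triangle_ineq4[of "f (inverse z) / (y powr (- \<rho>) * l y)" "s powr (- \<rho>)"] by simp
      also have "\<dots> \<le> (B * K2 * K3 + Y powr d * K4) * g y * s powr (- \<tau>)"
        using 1 2 by (simp add: algebra_simps)
      also have "\<dots> \<le> K * (g y + h y) * ?w"
        using ypos \<open>0 \<le> B\<close> K2(1) K3(1) K4(1) by (intro mult_mono) (auto simp: K_def le_max_iff_disj)
      finally show ?thesis by (simp add: z_def)
    qed
  qed
  then show ?thesis by (auto simp: eventually_at_top_linorder)
qed

subsection \<open>The convolution integral\<close>

text \<open>As \<open>f\<close> is only Lebesgue measurable, preimages of Lebesgue sets are needed.
  The map \<open>s \<mapsto> x / s\<close> is an involution of the half-line, so preimages are
  images, and differentiable images of Lebesgue sets are Lebesgue.\<close>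

lemma measurable_reciprocal_half_line:
  assumes f: "f \<in> borel_measurable half_line" and "0 < x"
  shows "(\<lambda>s. f (x / s)) \<in> borel_measurable half_line"
proof (rule measurable_compose[OF _ f], rule measurableI)
  fix A assume A: "A \<in> sets half_line"
  then have A': "A \<subseteq> {0<..}" "A \<in> sets lebesgue"
    by (auto simp: sets_restrict_space_iff dest: sets.sets_into_space)
  have "(\<lambda>s. x / s) -` A \<inter> {0<..} = (\<lambda>t. x / t) ` A"
  proof (intro equalityI subsetI)
    fix s assume "s \<in> (\<lambda>s. x / s) -` A \<inter> {0<..}"
    then show "s \<in> (\<lambda>t. x / t) ` A" using \<open>0 < x\<close> by (intro image_eqI[of _ _ "x / s"]) auto
  next
    fix s assume "s \<in> (\<lambda>t. x / t) ` A"
    then show "s \<in> (\<lambda>s. x / s) -` A \<inter> {0<..}" using \<open>0 < x\<close> A'(1) by auto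
  qed
  moreover have "(\<lambda>t. x / t) ` A \<in> sets lebesgue"
    using A' by (intro differentiable_image_in_sets_lebesgue)
      (auto simp: differentiable_on_def intro!: derivative_intros)
  ultimately show "(\<lambda>s. x / s) -` A \<inter> space half_line \<in> sets half_line"
    by (auto simp: sets_restrict_space_iff)
qed (use \<open>0 < x\<close> in auto)

lemma integrable_half_line_iff:
  fixes u :: "real \<Rightarrow> real"
  shows "integrable half_line u \<longleftrightarrow> u absolutely_integrable_on {0<..}"
  by (subst integrable_restrict_space) (auto simp: set_integrable_def)

text \<open>The substitution \<open>t = x / s\<close> preserves the measure \<open>dt / t\<close>
  and leaves \<open>U\<close> with an argument independent of \<open>x\<close>. The change of
  variables transfers integrability along with the value.\<close>

lemma mellin_conv_substitution:
  assumes "0 < x" and int: "integrable half_line (\<lambda>s. U s * f (x / s) / s)"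
  shows "mellin_conv_exists U f x"
    and "mellin_conv U f x = (LINT s|half_line. U s * f (x / s) / s)"
proof -
  define u where "u = (\<lambda>t. U (inverse t * x) * f t / t)"
  have eq: "\<bar>- x / s\<^sup>2\<bar> * u (x / s) = U s * f (x / s) / s" if "s \<in> {0<..}" for s
    using that \<open>0 < x\<close> by (simp add: u_def power2_eq_square field_simps)
  have img: "(\<lambda>s. x / s) ` {0<..} = {0<..}"
  proof (intro equalityI subsetI)
    fix s :: real assume "s \<in> {0<..}"
    then show "s \<in> (\<lambda>s. x / s) ` {0<..}" using \<open>0 < x\<close> by (intro image_eqI[of _ _ "x / s"]) auto
  qed (use \<open>0 < x\<close> in auto)
  have int': "(\<lambda>s. \<bar>- x / s\<^sup>2\<bar> * u (x / s)) absolutely_integrable_on {0<..}"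
    using int by (subst set_integrable_cong[OF refl refl eq]) (auto simp: integrable_half_line_iff)
  have val: "integral {0<..} (\<lambda>s. \<bar>- x / s\<^sup>2\<bar> * u (x / s)) = integral {0<..} (\<lambda>s. U s * f (x / s) / s)"
    by (rule integral_cong) (rule eq)
  have *: "u absolutely_integrable_on (\<lambda>s. x / s) ` {0<..} \<and>
      integral ((\<lambda>s. x / s) ` {0<..}) u = integral {0<..} (\<lambda>s. U s * f (x / s) / s)"
  proof (subst has_absolute_integral_change_of_variables_1'[symmetric])
    show "((\<lambda>s. x / s) has_field_derivative (- x / s\<^sup>2)) (at s within {0<..})" if "s \<in> {0<..}" for s
      using that by (auto intro!: derivative_eq_intros simp: power2_eq_square)
    show "inj_on (\<lambda>s. x / s) {0<..}" using \<open>0 < x\<close> by (auto simp: inj_on_def field_simps)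
  qed (use int' val in auto)
  then have u: "integrable half_line u" by (simp add: img integrable_half_line_iff)
  then show "mellin_conv_exists U f x" by (simp add: mellin_conv_exists_def u_def)
  have "mellin_conv U f x = integral {0<..} u"
    using u by (simp add: mellin_conv_def u_def lebesgue_integral_eq_integral)
  also have "\<dots> = (LINT s|half_line. U s * f (x / s) / s)"
    using * int by (simp add: img lebesgue_integral_eq_integral)
  finally show "mellin_conv U f x = (LINT s|half_line. U s * f (x / s) / s)" .
qed

lemma mellin_integrand_of_real:
  "0 < t \<Longrightarrow> mellin_integrand U (of_real a) t = of_real (t powr (- a) * U t / t)"
  by (simp add: mellin_integrand_def powr_of_real flip: of_real_minus)

lemma integrable_mellin_of_real:
  assumes "of_real a \<in> mellin_domain U"
  shows "integrable half_line (\<lambda>t. t powr (- a) * U t / t)"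
proof -
  have "integrable half_line (\<lambda>t. complex_of_real (t powr (- a) * U t / t))"
    using assms unfolding mellin_domain_def mem_Collect_eq
    by (subst (asm) Bochner_Integration.integrable_cong[OF refl mellin_integrand_of_real]) auto
  then show ?thesis unfolding complex_of_real_integrable_eq .
qed

lemma mellin_of_real:
  "mellin U (of_real a) = of_real (LINT t|half_line. t powr (- a) * U t / t)"
proof -
  have "mellin U (of_real a) = (LINT t|half_line. complex_of_real (t powr (- a) * U t / t))"
    unfolding mellin_def by (rule Bochner_Integration.integral_cong[OF refl mellin_integrand_of_real]) auto
  then show ?thesis unfolding integral_complex_of_real .
qed

text \<open>Up to the factor \<open>c\<close>, the integrand is the Mellin integrand at
  \<open>\<rho>\<close> plus a remainder dominated by \<open>B\<close> times the endpoint weights.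
  The domination also proves that the convolution exists.\<close>

lemma mellin_conv_estimate:
  fixes f l g h :: "real \<Rightarrow> real"
  assumes U: "U \<in> borel_measurable half_line"
    and dom: "of_real \<sigma> \<in> mellin_domain U" "of_real \<rho> \<in> mellin_domain U" "of_real \<tau> \<in> mellin_domain U"
    and f: "f \<in> borel_measurable half_line"
    and x: "0 < x" and c: "0 < c"
    and bound: "\<And>s. 0 < s \<Longrightarrow> \<bar>f (x / s) / c - s powr (- \<rho>)\<bar> \<le> B * (s powr (- \<sigma>) + s powr (- \<tau>))"
  shows "mellin_conv_exists U f x"
    and "\<bar>mellin_conv U f x / c - (LINT t|half_line. t powr (- \<rho>) * U t / t)\<bar>
           \<le> B * (LINT t|half_line. (t powr (- \<sigma>) + t powr (- \<tau>)) * \<bar>U t\<bar> / t)"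
proof -
  define m where "m = (\<lambda>t. t powr (- \<rho>) * U t / t)"
  define w where "w = (\<lambda>t. (t powr (- \<sigma>) + t powr (- \<tau>)) * \<bar>U t\<bar> / t)"
  \<comment> \<open>\<open>r\<close> is what remains of the integrand after dividing by
    \<open>c\<close> and subtracting \<open>m\<close>.\<close>
  define r where "r = (\<lambda>s. U s / s * (f (x / s) / c - s powr (- \<rho>)))"
  have m: "integrable half_line m" unfolding m_def by (rule integrable_mellin_of_real[OF dom(2)])
  have "integrable half_line (\<lambda>t. \<bar>t powr (- \<sigma>) * U t / t\<bar> + \<bar>t powr (- \<tau>) * U t / t\<bar>)"
    by (intro Bochner_Integration.integrable_add integrable_abs integrable_mellin_of_real dom)
  then have w: "integrable half_line w"
    by (rule Bochner_Integration.integrable_cong[THEN iffD1, rotated 2])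
       (auto simp: w_def abs_mult add_divide_distrib distrib_right)
  note [measurable] = measurable_reciprocal_half_line[OF f x] U
  have [measurable]: "(\<lambda>s::real. s) \<in> borel_measurable half_line"
    by (intro measurable_restrict_space1 measurable_completion) simp
  have r_meas: "r \<in> borel_measurable half_line"
    unfolding r_def by measurable
  have r_le: "\<bar>r s\<bar> \<le> B * w s" if "0 < s" for s
  proof -
    have "\<bar>r s\<bar> = \<bar>U s\<bar> / s * \<bar>f (x / s) / c - s powr (- \<rho>)\<bar>" using that by (simp add: r_def abs_mult)
    also have "\<dots> \<le> \<bar>U s\<bar> / s * (B * (s powr (- \<sigma>) + s powr (- \<tau>)))"
      using bound[OF that] that by (intro mult_left_mono) auto
    also have "\<dots> = B * w s" by (simp add: w_def)
    finally show ?thesis .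
  qed
  have Bw: "integrable half_line (\<lambda>s. B * w s)" using w by simp
  have r: "integrable half_line r"
    by (rule Bochner_Integration.integrable_bound[OF Bw r_meas])
       (auto intro!: AE_I2 order_trans[OF r_le abs_ge_self])
  have eq: "U s * f (x / s) / s = c * (m s + r s)" if "0 < s" for s
    using that c by (simp add: m_def r_def field_simps)
  have "integrable half_line (\<lambda>s. c * (m s + r s))" using m r by simp
  then have int: "integrable half_line (\<lambda>s. U s * f (x / s) / s)"
    by (rule Bochner_Integration.integrable_cong[THEN iffD2, rotated 2]) (use eq in auto)
  then show "mellin_conv_exists U f x" by (rule mellin_conv_substitution(1)[OF x])
  have "mellin_conv U f x = (LINT s|half_line. c * (m s + r s))"
    unfolding mellin_conv_substitution(2)[OF x int]
    by (rule Bochner_Integration.integral_cong) (use eq in auto)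
  then have conv: "mellin_conv U f x / c - integral\<^sup>L half_line m = integral\<^sup>L half_line r"
    using m r c by simp
  have "\<bar>integral\<^sup>L half_line r\<bar> \<le> (LINT s|half_line. \<bar>r s\<bar>)" by (rule integral_abs_bound)
  also have "\<dots> \<le> (LINT s|half_line. B * w s)"
    using r Bw by (intro Bochner_Integration.integral_mono) (auto simp: r_le)
  also have "\<dots> = B * integral\<^sup>L half_line w" by simp
  finally show "\<bar>mellin_conv U f x / c - (LINT t|half_line. t powr (- \<rho>) * U t / t)\<bar>
           \<le> B * (LINT t|half_line. (t powr (- \<sigma>) + t powr (- \<tau>)) * \<bar>U t\<bar> / t)"
    using conv by (simp add: m_def w_def)
qed

section \<open>Splitting the error and the final asymptotics\<close>

text \<open>\<open>R\<close> is divided in the proportion \<open>g : h\<close>. Positivity of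
  \<open>g\<close> keeps the denominator nonzero, and \<open>|L| + 1\<close> is a positive constant
  whatever the sign of \<open>L\<close>.\<close>

lemma bigo_add_split:
  fixes R g h :: "'a \<Rightarrow> real"
  assumes "\<forall>\<^sub>F x in F. \<bar>R x\<bar> \<le> L * (g x + h x)" "\<forall>\<^sub>F x in F. 0 < g x" "\<forall>\<^sub>F x in F. 0 \<le> h x"
  shows "\<exists>E1 E2. E1 \<in> O[F](g) \<and> E2 \<in> O[F](h) \<and> (\<forall>\<^sub>F x in F. R x = E1 x + E2 x)"
proof (intro exI conjI)
  have part: "norm (r * a / (p + q)) \<le> (\<bar>L\<bar> + 1) * norm a"
    if "\<bar>r\<bar> \<le> L * (p + q)" "0 < p" "0 \<le> q" for r a p q :: real
  proof -
    have "\<bar>r\<bar> / (p + q) \<le> L" using that by (simp add: divide_le_eq)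
    then have "\<bar>r\<bar> / (p + q) * \<bar>a\<bar> \<le> (\<bar>L\<bar> + 1) * \<bar>a\<bar>" by (intro mult_right_mono) auto
    with that show ?thesis by (simp add: abs_mult)
  qed
  show "(\<lambda>x. R x * g x / (g x + h x)) \<in> O[F](g)"
    by (rule landau_o.bigI[of "\<bar>L\<bar> + 1"], simp, use assms in eventually_elim) (rule part)
  show "(\<lambda>x. R x * h x / (g x + h x)) \<in> O[F](h)"
    by (rule landau_o.bigI[of "\<bar>L\<bar> + 1"], simp, use assms in eventually_elim) (rule part)
  show "\<forall>\<^sub>F x in F. R x = R x * g x / (g x + h x) + R x * h x / (g x + h x)"
    using assms(2,3) by eventually_elim (simp flip: add_divide_distrib distrib_left)
qed

(* The last conjunct is the relation conv = MU(rho) * x^rho * l(1/x) * (1 + O(g(1/x)) + O(h(1/x))).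
   Read literally for MU(rho) = 0 it would say that the convolution vanishes identically near 0,
   which fails already for U = 1 on (1,2], -1 on (2,4], 0 elsewhere, with rho = 0 and
   f(1/y) = l(y) = 1 + 1/ln y, g(y) = h(y) = 1/ln y for large y. The second conjunct covers
   all values of MU(rho), with the error taken relative to x^rho * l(1/x). *)
theorem theorem9:
  fixes U f l g h :: "real \<Rightarrow> real" and \<sigma> \<tau> \<rho> x\<^sub>0 :: real
  assumes "\<sigma> < \<tau>"
    and "U \<in> borel_measurable half_line"
    and "{z. \<sigma> \<le> Re z \<and> Re z \<le> \<tau>} \<subseteq> mellin_domain U"
    and "f \<in> borel_measurable half_line"
    and "\<sigma> < \<rho>" and "\<rho> < \<tau>"
    and "g \<in> slowly_varying" and "(g \<longlongrightarrow> 0) at_top"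
    and "l \<in> slowly_varying_rem g"
    and "h \<in> zygmund" and "(h \<longlongrightarrow> 0) at_top"
    and "\<exists>E. E \<in> O[at_top](h) \<and>
           (\<forall>\<^sub>F y in at_top. f (inverse y) = y powr (-\<rho>) * l y * (1 + E y))"
    and "0 < x\<^sub>0"
    and "locally_bounded_on {x\<^sub>0<..} g"
    and "reciprocal_locally_bounded_on {x\<^sub>0<..} l"
    and "reciprocal_locally_bounded_on {x\<^sub>0<..} g"
    and "\<forall>a>0. bounded ((\<lambda>y. y powr \<tau> * f (inverse y)) ` {0<..a})"
  shows "(\<forall>\<^sub>F x in at_right 0. mellin_conv_exists U f x) \<and>
    (\<exists>E\<^sub>1 E\<^sub>2 :: real \<Rightarrow> real.
        E\<^sub>1 \<in> O[at_right 0](\<lambda>x. g (inverse x)) \<and> E\<^sub>2 \<in> O[at_right 0](\<lambda>x. h (inverse x)) \<and>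
        (\<forall>\<^sub>F x in at_right 0. complex_of_real (mellin_conv U f x) =
           of_real (x powr \<rho> * l (inverse x)) *
           (mellin U (of_real \<rho>) + of_real (E\<^sub>1 x) + of_real (E\<^sub>2 x)))) \<and>
    (mellin U (of_real \<rho>) \<noteq> 0 \<longrightarrow>
     (\<exists>E\<^sub>1 E\<^sub>2 :: real \<Rightarrow> real.
        E\<^sub>1 \<in> O[at_right 0](\<lambda>x. g (inverse x)) \<and> E\<^sub>2 \<in> O[at_right 0](\<lambda>x. h (inverse x)) \<and>
        (\<forall>\<^sub>F x in at_right 0. complex_of_real (mellin_conv U f x) =
           mellin U (of_real \<rho>) * of_real (x powr \<rho> * l (inverse x)) *
           (1 + of_real (E\<^sub>1 x) + of_real (E\<^sub>2 x)))))"
proof -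
  obtain E where E: "E \<in> O[at_top](h)"
      "\<forall>\<^sub>F y in at_top. f (inverse y) = y powr (-\<rho>) * l y * (1 + E y)"
    using assms(12) by blast
  have dom: "of_real \<sigma> \<in> mellin_domain U" "of_real \<rho> \<in> mellin_domain U" "of_real \<tau> \<in> mellin_domain U"
    using assms(1,3,5,6) by auto
  obtain K where K: "\<forall>\<^sub>F y in at_top. \<forall>s>0. \<bar>f (inverse (y * s)) / (y powr (- \<rho>) * l y) - s powr (- \<rho>)\<bar>
           \<le> K * (g y + h y) * (s powr (- \<sigma>) + s powr (- \<tau>))"
    using mellin_kernel_error_bound[OF assms(5,6,7,8,9,10) E] assms(17) by blast
  define c where "c = (\<lambda>x. x powr \<rho> * l (inverse x))"
  define M where "M = (LINT t|half_line. t powr (- \<rho>) * U t / t)"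
  define I where "I = (LINT t|half_line. (t powr (- \<sigma>) + t powr (- \<tau>)) * \<bar>U t\<bar> / t)"
  define R where "R = (\<lambda>x. mellin_conv U f x / c x - M)"
  have mellin_eq: "mellin U (of_real \<rho>) = of_real M" by (simp add: mellin_of_real M_def)
  have ev: "\<forall>\<^sub>F x in at_right 0. 0 < c x \<and> 0 < g (inverse x) \<and> 0 \<le> h (inverse x)
      \<and> mellin_conv_exists U f x \<and> \<bar>R x\<bar> \<le> (K * I) * (g (inverse x) + h (inverse x))"
    \<comment> \<open>With \<open>x = inverse y\<close> the limit at \<open>0\<close> from the right
      becomes one at infinity, where the kernel estimate lives.\<close>
    unfolding eventually_at_right_to_top
    using K slowly_varying_eventually_pos[OF assms(7)] eventually_gt_at_top[of "0::real"]
      slowly_varying_eventually_pos[OF slowly_varying_rem_imp_slowly_varying[OF assms(9,8)]]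
  proof eventually_elim
    case (elim y)
    have c: "c (inverse y) = y powr (- \<rho>) * l y"
      using elim by (simp add: c_def powr_minus inverse_eq_divide powr_divide)
    then have cpos: "0 < c (inverse y)" using elim by simp
    have "\<bar>f (inverse y / s) / c (inverse y) - s powr (- \<rho>)\<bar>
        \<le> K * (g y + h y) * (s powr (- \<sigma>) + s powr (- \<tau>))" if "0 < s" for s
      using elim that unfolding c by (simp add: divide_inverse)
    note est = mellin_conv_estimate[OF assms(2) dom assms(4) _ cpos this]
    have "0 \<le> h y" using assms(10) elim by (auto simp: zygmund_def nonneg_measurable_def)
    moreover have "\<bar>R (inverse y)\<bar> \<le> K * (g y + h y) * I"
      unfolding R_def M_def I_def by (rule est(2)) (use elim in auto)
    moreover have "mellin_conv_exists U f (inverse y)" by (rule est(1)) (use elim in auto)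
    ultimately show ?case using elim cpos by (simp add: mult_ac)
  qed
  have "\<exists>E1 E2. E1 \<in> O[at_right 0](\<lambda>x. g (inverse x)) \<and> E2 \<in> O[at_right 0](\<lambda>x. h (inverse x))
      \<and> (\<forall>\<^sub>F x in at_right 0. R x = E1 x + E2 x)"
    by (rule bigo_add_split[where L = "K * I"]; use ev in eventually_elim) auto
  then obtain E1 E2 where E12: "E1 \<in> O[at_right 0](\<lambda>x. g (inverse x))"
      "E2 \<in> O[at_right 0](\<lambda>x. h (inverse x))" "\<forall>\<^sub>F x in at_right 0. R x = E1 x + E2 x"
    by blast
  have conv: "\<forall>\<^sub>F x in at_right 0. mellin_conv U f x = c x * (M + E1 x + E2 x)"
    using ev E12(3)
  proof eventually_elim
    case (elim x)
    then have "c x \<noteq> 0" "E1 x = mellin_conv U f x / c x - M - E2 x" by (auto simp: R_def)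
    then show ?case by (simp add: field_simps)
  qed
  have "\<forall>\<^sub>F x in at_right 0. complex_of_real (mellin_conv U f x) =
      of_real (x powr \<rho> * l (inverse x)) * (mellin U (of_real \<rho>) + of_real (E1 x) + of_real (E2 x))"
    using conv by eventually_elim (simp add: mellin_eq c_def)
  \<comment> \<open>For \<open>M \<noteq> 0\<close> the same errors divided by \<open>M\<close> give
    the relative form.\<close>
  moreover have "\<exists>E\<^sub>1 E\<^sub>2 :: real \<Rightarrow> real.
        E\<^sub>1 \<in> O[at_right 0](\<lambda>x. g (inverse x)) \<and> E\<^sub>2 \<in> O[at_right 0](\<lambda>x. h (inverse x)) \<and>
        (\<forall>\<^sub>F x in at_right 0. complex_of_real (mellin_conv U f x) =
           mellin U (of_real \<rho>) * of_real (x powr \<rho> * l (inverse x)) *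
           (1 + of_real (E\<^sub>1 x) + of_real (E\<^sub>2 x)))" if "mellin U (of_real \<rho>) \<noteq> 0"
  proof (intro exI conjI)
    have "M \<noteq> 0" using that by (simp add: mellin_eq)
    then show "(\<lambda>x. E1 x / M) \<in> O[at_right 0](\<lambda>x. g (inverse x))"
      "(\<lambda>x. E2 x / M) \<in> O[at_right 0](\<lambda>x. h (inverse x))"
      using E12 by simp_all
    show "\<forall>\<^sub>F x in at_right 0. complex_of_real (mellin_conv U f x) =
           mellin U (of_real \<rho>) * of_real (x powr \<rho> * l (inverse x)) *
           (1 + of_real (E1 x / M) + of_real (E2 x / M))"
      using conv
    proof eventually_elim
      case (elim x)
      then have "mellin_conv U f x = M * c x * (1 + E1 x / M + E2 x / M)"
        using \<open>M \<noteq> 0\<close> by (simp add: field_simps)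
      then show ?case by (simp add: mellin_eq c_def)
    qed
  qed
  moreover have "\<forall>\<^sub>F x in at_right 0. mellin_conv_exists U f x"
    using ev by eventually_elim simp
  ultimately show ?thesis using E12(1,2) by blast
qed

end
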